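(* Let $\mathfrak{g}$ be an almost abelian Lie algebra equipped with a complex structure $J$. If $(\mathfrak{g},J)$ has a balanced $J$-Hermitian metric and a twisted SKT $J$-Hermitian metric, then $(\mathfrak{g},J)$ has a Kähler metric.
   Context: All Lie algebras are real and finite-dimensional. An almost abelian Lie algebra is a non-abelian Lie algebra $\mathfrak{g}$ with a codimension-one abelian ideal $\mathfrak{n}$. A complex structure on $\mathfrak{g}$ is an endomorphism $J$ with $J^2=-\mathrm{id}$ and $[JX,JY]-[X,Y]-J[JX,Y]-J[X,JY]=0$ for all $X,Y$. A $J$-Hermitian metric is an inner product $g$ on $\mathfrak{g}$ compatible with $J$, i.e. $g(JX,JY)=g(X,Y)$. Its fundamental form is $\omega(X,Y)=g(JX,Y)$ and its Bismut torsion 3-form is $H(X,Y,Z)=-d\omega(JX,JY,JZ)$, where $d$ is the Chevalley–Eilenberg differential (on 1-forms, $d\alpha(X,Y)=-\alpha([X,Y])$). The metric $g$ is twisted SKT if $dH=\alpha\wedge H$ for some closed 1-form $\alpha\in\mathfrak{g}^*$ (possibly zero). It is Kähler if $d\omega=0$ (equivalently $H=0$). The Lee form of $(J,g)$ is the 1-form $\theta=J d^*\omega$ (where $d^*\omega=\star d\star\omega$ and $\star$ is the Hodge star operator), and $g$ is balanced if $\theta=0$. *)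

theory Defs
  imports "HOL-Analysis.Linear_Algebra" "Jordan_Normal_Form.Determinant"
begin

section \<open>Almost abelian Lie algebras\<close>

definition lie_algebra :: "('a::real_vector \<Rightarrow> 'a \<Rightarrow> 'a) \<Rightarrow> bool" where
  "lie_algebra br \<longleftrightarrow>
     bilinear br \<and>
     (\<forall>x. br x x = 0) \<and>
     (\<forall>x y z. br x (br y z) + br y (br z x) + br z (br x y) = 0)"

definition abelian_ideal :: "('a::real_vector \<Rightarrow> 'a \<Rightarrow> 'a) \<Rightarrow> 'a set \<Rightarrow> bool" where
  "abelian_ideal br N \<longleftrightarrow>
     subspace N \<and>
     (\<forall>x. \<forall>y\<in>N. br x y \<in> N) \<and>
     (\<forall>x\<in>N. \<forall>y\<in>N. br x y = 0)"

definition almost_abelian :: "('a::real_vector \<Rightarrow> 'a \<Rightarrow> 'a) \<Rightarrow> bool" where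
  "almost_abelian br \<longleftrightarrow>
     (\<exists>B::'a set. finite B \<and> span B = UNIV) \<and>
     lie_algebra br \<and>
     (\<exists>x y. br x y \<noteq> 0) \<and>
     (\<exists>N. abelian_ideal br N \<and> dim N + 1 = dim (UNIV :: 'a set))"

definition complex_structure ::
    "('a::real_vector \<Rightarrow> 'a \<Rightarrow> 'a) \<Rightarrow> ('a \<Rightarrow> 'a) \<Rightarrow> bool" where
  "complex_structure br J \<longleftrightarrow>
     linear J \<and>
     (\<forall>x. J (J x) = - x) \<and>
     (\<forall>x y. br (J x) (J y) - br x y - J (br (J x) y) - J (br x (J y)) = 0)"

definition inner_product :: "('a::real_vector \<Rightarrow> 'a \<Rightarrow> real) \<Rightarrow> bool" where
  "inner_product g \<longleftrightarrow>
     bilinear g \<and> (\<forall>x y. g x y = g y x) \<and> (\<forall>x. x \<noteq> 0 \<longrightarrow> g x x > 0)"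

definition hermitian_metric ::
    "('a::real_vector \<Rightarrow> 'a) \<Rightarrow> ('a \<Rightarrow> 'a \<Rightarrow> real) \<Rightarrow> bool" where
  "hermitian_metric J g \<longleftrightarrow> inner_product g \<and> (\<forall>x y. g (J x) (J y) = g x y)"

section \<open>Forms and the Chevalley--Eilenberg differential\<close>

text \<open>
  A \<open>k\<close>-form is represented by a function on lists of vectors, of which only the values on lists
  of length \<open>k\<close> are meaningful. The degree is never passed explicitly: each operator below reads
  it off from the length of the list at which the result is evaluated.
\<close>

type_synonym 'a form = "'a list \<Rightarrow> real"

definition one_form :: "('a \<Rightarrow> real) \<Rightarrow> 'a form" where
  "one_form \<alpha> Xs = \<alpha> (Xs ! 0)"

text \<open>
  With indices from 0,
  \<open>d\<phi>(X\<^sub>0,\<dots>,X\<^sub>k) = \<Sum>\<^sub>i\<^sub><\<^sub>j (-1)\<^sup>i\<^sup>+\<^sup>j \<phi>([X\<^sub>i,X\<^sub>j], X\<^sub>0,\<dots>,X\<^sub>k)\<close>,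
  where \<open>X\<^sub>i\<close> and \<open>X\<^sub>j\<close> are omitted from the remaining arguments; on 1-forms this is
  \<open>d\<alpha>(X,Y) = -\<alpha>([X,Y])\<close>.
\<close>

definition ce_d :: "('a \<Rightarrow> 'a \<Rightarrow> 'a) \<Rightarrow> 'a form \<Rightarrow> 'a form" where
  "ce_d br \<phi> Xs =
     (\<Sum>j<length Xs. \<Sum>i<j. (-1) ^ (i + j) * \<phi> (br (Xs ! i) (Xs ! j) # nths Xs (- {i, j})))"

definition wedge1 :: "('a \<Rightarrow> real) \<Rightarrow> 'a form \<Rightarrow> 'a form" where
  "wedge1 \<alpha> \<phi> Xs = (\<Sum>i<length Xs. (-1) ^ i * \<alpha> (Xs ! i) * \<phi> (nths Xs (- {i})))"

definition closed_one_form :: "('a::real_vector \<Rightarrow> 'a \<Rightarrow> 'a) \<Rightarrow> ('a \<Rightarrow> real) \<Rightarrow> bool" where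
  "closed_one_form br \<alpha> \<longleftrightarrow> linear \<alpha> \<and> (\<forall>X Y. ce_d br (one_form \<alpha>) [X, Y] = 0)"

section \<open>Kaehler and twisted SKT metrics\<close>

definition fundamental_form :: "('a \<Rightarrow> 'a) \<Rightarrow> ('a \<Rightarrow> 'a \<Rightarrow> real) \<Rightarrow> 'a form" where
  "fundamental_form J g Xs = g (J (Xs ! 0)) (Xs ! 1)"

definition bismut_torsion ::
    "('a \<Rightarrow> 'a \<Rightarrow> 'a) \<Rightarrow> ('a \<Rightarrow> 'a) \<Rightarrow> ('a \<Rightarrow> 'a \<Rightarrow> real) \<Rightarrow> 'a form" where
  "bismut_torsion br J g Xs = - ce_d br (fundamental_form J g) (map J Xs)"

definition kaehler ::
    "('a \<Rightarrow> 'a \<Rightarrow> 'a) \<Rightarrow> ('a \<Rightarrow> 'a) \<Rightarrow> ('a \<Rightarrow> 'a \<Rightarrow> real) \<Rightarrow> bool" where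
  "kaehler br J g \<longleftrightarrow> (\<forall>X Y Z. ce_d br (fundamental_form J g) [X, Y, Z] = 0)"

definition twisted_SKT ::
    "('a::real_vector \<Rightarrow> 'a \<Rightarrow> 'a) \<Rightarrow> ('a \<Rightarrow> 'a) \<Rightarrow> ('a \<Rightarrow> 'a \<Rightarrow> real) \<Rightarrow> bool" where
  "twisted_SKT br J g \<longleftrightarrow>
     (\<exists>\<alpha>. closed_one_form br \<alpha> \<and>
        (\<forall>X Y Z W. ce_d br (bismut_torsion br J g) [X, Y, Z, W] =
                    wedge1 \<alpha> (bismut_torsion br J g) [X, Y, Z, W]))"

section \<open>The Hodge star operator and the Lee form\<close>

text \<open>
  Ordered bases \<open>e\<^sub>0, Je\<^sub>0, e\<^sub>2, Je\<^sub>2, \<dots>\<close>, orthonormal for the Hermitian metric \<open>g\<close>. They exist, and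
  all of them induce the same orientation (the one defined by \<open>J\<close>), so that the volume form and
  the Hodge star operator below depend only on \<open>g\<close> and \<open>J\<close>.
\<close>

definition unitary_basis ::
    "('a::real_vector \<Rightarrow> 'a) \<Rightarrow> ('a \<Rightarrow> 'a \<Rightarrow> real) \<Rightarrow> 'a list \<Rightarrow> bool" where
  "unitary_basis J g es \<longleftrightarrow>
     length es = dim (UNIV :: 'a set) \<and>
     (\<forall>i<length es. \<forall>j<length es. g (es ! i) (es ! j) = (if i = j then 1 else 0)) \<and>
     (\<forall>i. 2 * i + 1 < length es \<longrightarrow> es ! (2 * i + 1) = J (es ! (2 * i)))"

definition volume_form :: "('a \<Rightarrow> 'a \<Rightarrow> real) \<Rightarrow> 'a list \<Rightarrow> 'a form" where
  "volume_form g es Xs = det (mat (length es) (length Xs) (\<lambda>(i, j). g (es ! i) (Xs ! j)))"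

text \<open>
  For an oriented orthonormal basis \<open>es\<close> of length \<open>m\<close> and a \<open>k\<close>-form \<open>\<phi>\<close>, the \<open>(m-k)\<close>-form
  \<open>\<star>\<phi>\<close> is the contraction of the volume form with \<open>\<phi>\<close>, that is,
  \<open>(\<star>\<phi>)(Y\<^sub>1,\<dots>) = \<Sum>\<^sub>I \<phi>(e\<^sub>I) vol(e\<^sub>I,Y\<^sub>1,\<dots>)\<close> over increasing multi-indices \<open>I\<close> of length \<open>k\<close>. This is
  the normalisation \<open>\<beta> \<and> \<star>\<phi> = g(\<beta>,\<phi>) vol\<close>.
\<close>

definition hodge_star :: "('a \<Rightarrow> 'a \<Rightarrow> real) \<Rightarrow> 'a list \<Rightarrow> 'a form \<Rightarrow> 'a form" where
  "hodge_star g es \<phi> Ys =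
     (\<Sum>I | I \<subseteq> {..<length es} \<and> card I + length Ys = length es.
        \<phi> (nths es I) * volume_form g es (nths es I @ Ys))"

text \<open>
  The convention is \<open>d\<^sup>* = \<star>d\<star>\<close>, without the sign \<open>-1\<close> that the formal adjoint has in even dimension.
  The action of \<open>J\<close> on 1-forms is \<open>(J\<alpha>)(X) = \<alpha>(JX)\<close>; with these signs the Lee form is the
  \<open>\<theta>\<close> with \<open>d\<omega>\<^sup>n\<^sup>-\<^sup>1 = \<theta> \<and> \<omega>\<^sup>n\<^sup>-\<^sup>1\<close> for \<open>2n\<close> the dimension.
\<close>

definition lee_form ::
    "('a::real_vector \<Rightarrow> 'a \<Rightarrow> 'a) \<Rightarrow> ('a \<Rightarrow> 'a) \<Rightarrow> ('a \<Rightarrow> 'a \<Rightarrow> real) \<Rightarrow> 'a \<Rightarrow> real" where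
  "lee_form br J g X =
     (let es = (SOME es. unitary_basis J g es) in
        hodge_star g es (ce_d br (hodge_star g es (fundamental_form J g))) [J X])"

definition balanced ::
    "('a::real_vector \<Rightarrow> 'a \<Rightarrow> 'a) \<Rightarrow> ('a \<Rightarrow> 'a) \<Rightarrow> ('a \<Rightarrow> 'a \<Rightarrow> real) \<Rightarrow> bool" where
  "balanced br J g \<longleftrightarrow> (\<forall>X. lee_form br J g X = 0)"

end

theory Submission
  imports Defs
begin

text \<open>
  Let \<open>e\<close> be a linear functional with kernel the abelian ideal, \<open>e(E) = 1\<close>, \<open>e(JE) = 0\<close>, \<open>B = ad\<^sub>E\<close>
  and \<open>\<nn>\<^sub>1 = ker e \<inter> ker (e \<circ> J)\<close>. Integrability of \<open>J\<close> says that \<open>B\<close> preserves \<open>\<nn>\<^sub>1\<close> and commutes with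
  \<open>J\<close> there. Computing \<open>\<star>d\<star>\<omega>\<close> in a unitary basis turns the balanced condition into
  \<open>B(JE) = tr(B) JE\<close> for \<open>E\<close> normal to the ideal (in the balanced metric), so that \<open>B\<close> is trace-free on \<open>\<nn>\<^sub>1\<close>.
  For the twisted SKT metric let \<open>A\<close> be the restriction of \<open>B\<close> to \<open>\<nn>\<^sub>1\<close> and \<open>S = A + A\<^sup>T\<close>. If the twisting form
  vanishes on \<open>\<nn>\<^sub>1\<close>, the twisted SKT equation reads \<open>SA + A\<^sup>TS + cS = 0\<close>, whose trace is
  \<open>tr(S\<^sup>2) + 2c tr(A) = tr(S\<^sup>2)\<close>; otherwise the equation \<open>\<alpha> \<and> H = 0\<close> on the ideal forces \<open>S = 0\<close> directly.
  So \<open>A\<close> is skew, and the twisted SKT metric on \<open>\<nn>\<^sub>1\<close>, extended by declaring the balanced \<open>E\<close> and \<open>JE\<close>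
  orthonormal and orthogonal to \<open>\<nn>\<^sub>1\<close>, is Kaehler.
\<close>

section \<open>The Hodge star in an orthonormal frame\<close>

lemma nths_none: "(\<And>i. i < length xs \<Longrightarrow> i \<notin> I) \<Longrightarrow> nths xs I = []"
  by (auto simp: length_nths simp flip: length_0_conv)

lemma nths_pair: "nths (U @ x # V @ y # W) {length U, length U + length V + 1} = [x, y]"
  by (simp add: nths_append nths_Cons nths_none)

text \<open>\<open>expand\<close> encodes that the list spans, so the frame carries
  finite-dimensionality and all contractions below are finite sums over it.\<close>

locale orthonormal_frame =
  fixes g :: "'a::real_vector \<Rightarrow> 'a \<Rightarrow> real" and es :: "'a list"
  assumes inner: "inner_product g"
    and orthonormal: "\<And>i j. i < length es \<Longrightarrow> j < length es \<Longrightarrow> g (es ! i) (es ! j) = (if i = j then 1 else 0)"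
    and expand: "\<And>x. (\<Sum>i<length es. g x (es ! i) *\<^sub>R es ! i) = x"
begin

abbreviation "m \<equiv> length es"
abbreviation "vol \<equiv> volume_form g es"

lemma g_bilinear: "bilinear g"
  using inner unfolding inner_product_def by auto

lemma g_sym: "g x y = g y x"
  using inner unfolding inner_product_def by auto

section \<open>The volume form on rearranged and modified frames\<close>

lemma vol_exchange:
  assumes "length (P @ x # Q @ y # R) = m"
  shows "vol (P @ x # Q @ y # R) = - vol (P @ y # Q @ x # R)"
proof -
  let ?M = "\<lambda>Xs. mat m (length Xs) (\<lambda>(i, j). g (es ! i) (Xs ! j))"
  let ?k = "length P" and ?l = "length P + Suc (length Q)"
  have lt: "?k < m" "?l < m" using assms by auto
  have "?M (P @ y # Q @ x # R) = swapcols ?k ?l (?M (P @ x # Q @ y # R))"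
    using assms by (intro eq_matI) (auto simp: nth_append nth_Cons' mat_swapcols_def)
  moreover have "det (swapcols ?k ?l (?M (P @ x # Q @ y # R))) = - det (?M (P @ x # Q @ y # R))"
    using lt assms by (intro det_swapcols[where n = m]) auto
  ultimately show ?thesis
    by (simp add: volume_form_def)
qed

lemma vol_not_distinct:
  assumes "length Xs = m" "\<not> distinct Xs"
  shows "vol Xs = 0"
proof -
  obtain i j where ij: "i < m" "j < m" "i \<noteq> j" "Xs ! i = Xs ! j"
    using assms unfolding distinct_conv_nth by auto
  then show ?thesis
    unfolding volume_form_def using assms(1)
    by (intro det_identical_columns[where i = i and j = j and n = m]) (auto intro!: eq_vecI)
qed

text \<open>\<open>x\<close> travels rightwards through \<open>Q\<close> by adjacent exchanges, each
  costing a sign.\<close>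

lemma vol_move:
  "length (P @ x # Q @ R) = m \<Longrightarrow> vol (P @ x # Q @ R) = (- 1) ^ length Q * vol (P @ Q @ x # R)"
proof (induction Q arbitrary: P)
  case (Cons q Q)
  have "vol (P @ x # (q # Q) @ R) = - vol ((P @ [q]) @ x # Q @ R)"
    using vol_exchange[of P x "[]" q "Q @ R"] Cons.prems by simp
  also have "\<dots> = - ((- 1) ^ length Q * vol ((P @ [q]) @ Q @ x # R))"
    by (subst Cons.IH) (use Cons.prems in auto)
  finally show ?case by simp
qed simp

text \<open>The Gram matrix is the identity outside column \<open>k\<close>, so the expansion along
  row \<open>k\<close> keeps only the diagonal entry.\<close>

lemma vol_replace:
  assumes k: "k < m"
  shows "vol (es[k := Z]) = g (es ! k) Z"
proof -
  let ?M = "mat m m (\<lambda>(i, j). g (es ! i) (es[k := Z] ! j))"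
  have "mat_delete ?M k k = 1\<^sub>m (m - 1)"
    using k by (intro eq_matI) (auto simp: mat_delete_def nth_list_update orthonormal)
  then have cof: "cofactor ?M k k = 1"
    by (simp add: cofactor_def)
  have "det ?M = (\<Sum>j<m. ?M $$ (k, j) * cofactor ?M k j)"
    using k by (intro laplace_expansion_row) auto
  also have "\<dots> = (\<Sum>j<m. if j = k then g (es ! k) Z else 0)"
    using k cof by (intro sum.cong) (auto simp: nth_list_update orthonormal)
  also have "\<dots> = g (es ! k) Z"
    using k by simp
  finally show ?thesis
    by (simp add: volume_form_def)
qed

text \<open>Bringing \<open>Y\<close> from the end into slot \<open>k\<close> passes
  \<open>m - 1 - k\<close> vectors and yields the frame with entry \<open>k\<close>
  replaced.\<close>

lemma vol_omit1:
  assumes k: "k < m"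
  shows "vol (nths es (- {k}) @ [Y]) = (- 1) ^ (m - 1 - k) * g (es ! k) Y"
proof -
  obtain P x R where es: "es = P @ x # R" and P: "length P = k"
    using id_take_nth_drop[OF k] k by (metis length_take min.absorb4)
  have nths: "nths es (- {k}) = P @ R"
    unfolding es P[symmetric] by (simp add: nths_append nths_Cons nths_all)
  have len: "length R = m - 1 - k"
    using P by (simp add: es)
  have upd: "P @ Y # R = es[k := Y]"
    using P by (simp add: es list_update_append)
  have "vol (es[k := Y]) = (- 1) ^ length R * vol (P @ R @ [Y])"
    using vol_move[of P Y R "[]"] unfolding upd[symmetric] by (simp add: es)
  then have "vol (P @ R @ [Y]) = (- 1) ^ length R * vol (es[k := Y])"
    by (simp flip: mult.assoc power_add)
  then show ?thesis
    using vol_replace[OF k] nths len by simp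
qed

section \<open>The Hodge star on forms of degree \<open>m - 1\<close> and on 2-forms\<close>

lemma hodge_star_codim1:
  "hodge_star g es \<psi> [Y] = (\<Sum>k<m. \<psi> (nths es (- {k})) * ((- 1) ^ (m - 1 - k) * g (es ! k) Y))"
proof -
  have restr: "nths es ({..<m} - {k}) = nths es (- {k})" for k
    unfolding nths_def by (intro arg_cong[where f = "map fst"] filter_cong) (auto dest: set_zip_rightD)
  have "hodge_star g es \<psi> [Y] = (\<Sum>k<m. \<psi> (nths es ({..<m} - {k})) * vol (nths es ({..<m} - {k}) @ [Y]))"
    unfolding hodge_star_def
  \<comment> \<open>An index set of size \<open>m - 1\<close> is labelled by the one index it
    misses, which \<open>THE\<close> recovers.\<close>
  proof (rule sum.reindex_bij_witness[where i = "\<lambda>k. {..<m} - {k}" and j = "\<lambda>I. THE k. k \<in> {..<m} - I"])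
    fix I assume "I \<in> {I. I \<subseteq> {..<m} \<and> card I + length [Y] = m}"
    then have I: "I \<subseteq> {..<m}" "card I + 1 = m" by auto
    then have "card ({..<m} - I) = 1"
      by (subst card_Diff_subset) (auto intro: finite_subset)
    then obtain k where k: "{..<m} - I = {k}"
      using card_1_singletonE by blast
    have the: "(THE k. k \<in> {..<m} - I) = k" using k by simp
    show "{..<m} - {THE k. k \<in> {..<m} - I} = I" unfolding the using k I by blast
    show "(THE k. k \<in> {..<m} - I) \<in> {..<m}" unfolding the using k by blast
    show "\<psi> (nths es ({..<m} - {THE k. k \<in> {..<m} - I})) *
       vol (nths es ({..<m} - {THE k. k \<in> {..<m} - I}) @ [Y]) = \<psi> (nths es I) * vol (nths es I @ [Y])"
      unfolding \<open>{..<m} - {THE k. k \<in> {..<m} - I} = I\<close> ..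
  next
    fix k assume "k \<in> {..<m}"
    then have k: "k < m" by auto
    have "{..<m} - ({..<m} - {k}) = {k}" using k by auto
    then show "(THE l. l \<in> {..<m} - ({..<m} - {k})) = k" by simp
    show "{..<m} - {k} \<in> {I. I \<subseteq> {..<m} \<and> card I + length [Y] = m}"
      using k by auto
  qed
  then show ?thesis
    by (simp add: restr vol_omit1)
qed

text \<open>Only pairs inside \<open>{a, b, c}\<close> contribute: any other pair repeats a frame
  vector among the remaining arguments. Each surviving pair leaves a single slot of the frame for
  \<open>Z\<close>.\<close>

lemma hodge_star_codim2:
  assumes abc: "a < b" "b < c" "c < m"
  shows "hodge_star g es \<phi> (Z # nths es (- {a, b, c})) =
    (- 1) ^ (a + b + c + 1) *
    (\<phi> [es ! a, es ! b] * g (es ! c) Z - \<phi> [es ! a, es ! c] * g (es ! b) Z + \<phi> [es ! b, es ! c] * g (es ! a) Z)"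
proof -
  define P Q R S where "P = take a es" and "Q = take (b - Suc a) (drop (Suc a) es)"
    and "R = take (c - Suc b) (drop (Suc b) es)" and "S = drop (Suc c) es"
  have len: "length P = a" "length Q = b - Suc a" "length R = c - Suc b" "length S = m - Suc c"
    using abc by (auto simp: P_def Q_def R_def S_def)
  have d2: "drop (Suc b) es = R @ es ! c # S"
    using abc id_take_nth_drop[of "c - Suc b" "drop (Suc b) es"] by (simp add: R_def S_def)
  have d1: "drop (Suc a) es = Q @ es ! b # R @ es ! c # S"
    using abc id_take_nth_drop[of "b - Suc a" "drop (Suc a) es"] d2 by (simp add: Q_def)
  have es: "es = P @ es ! a # Q @ es ! b # R @ es ! c # S"
    using abc id_take_nth_drop[of a es] d1 by (simp add: P_def)
  have b: "b = length P + length Q + 1" and c: "c = length P + length Q + length R + 2"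
    using abc by (auto simp: len)
  have omit: "nths es (- {a, b, c}) = P @ Q @ R @ S"
    unfolding len(1)[symmetric] b c by (subst es) (simp add: nths_append nths_Cons nths_all)
  \<comment> \<open>Returning \<open>z\<close>, \<open>y\<close>, \<open>x\<close> to the slots
    \<open>c\<close>, \<open>b\<close>, \<open>a\<close> passes \<open>c - 2\<close>,
    \<open>b - 1\<close> and \<open>a\<close> vectors, which has the parity of
    \<open>a + b + c + 1\<close>.\<close>
  have front: "vol (x # y # z # P @ Q @ R @ S) = (- 1) ^ (a + b + c + 1) * vol (P @ x # Q @ y # R @ z # S)" for x y z
  proof -
    have m: "m = length P + length Q + length R + length S + 3"
      using len abc by simp
    have "vol (x # y # z # P @ Q @ R @ S) = (- 1) ^ c * (- 1) ^ Suc (b + a) * vol (P @ x # Q @ y # R @ z # S)"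
      using vol_move[of "[x, y]" z "P @ Q @ R" S] vol_move[of "[x]" y "P @ Q" "R @ z # S"]
        vol_move[of "[]" x P "Q @ y # R @ z # S"] m
      by (simp add: b c len(1) power_add)
    then show ?thesis by (simp add: power_add mult_ac)
  qed
  have upd: "P @ es ! a # Q @ es ! b # R @ Z # S = es[c := Z]"
    by (subst (3) es) (simp add: list_update_append c)
  have upd': "P @ es ! a # Q @ Z # R @ es ! c # S = es[b := Z]"
    by (subst (3) es) (simp add: list_update_append b)
  have upd'': "P @ Z # Q @ es ! b # R @ es ! c # S = es[a := Z]"
    by (subst (3) es) (simp add: list_update_append len(1)[symmetric])
  have m: "length (P @ x # Q @ y # R @ z # S) = m" for x y z
    using es by (metis length_append length_Cons)
  have vab: "vol (P @ es ! a # Q @ es ! b # R @ Z # S) = g (es ! c) Z"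
    unfolding upd using abc by (simp add: vol_replace)
  \<comment> \<open>Exchanges put the frame vectors back into their own slots and \<open>Z\<close>
    into the vacant one: one exchange here, two for \<open>vbc\<close>.\<close>
  have vac: "vol (P @ es ! a # Q @ es ! c # R @ Z # S) = - g (es ! b) Z"
    using vol_exchange[of "P @ es ! a # Q" "es ! c" R Z S] m upd' abc by (simp add: vol_replace)
  have vbc: "vol (P @ es ! b # Q @ es ! c # R @ Z # S) = g (es ! a) Z"
    using vol_exchange[of "P @ es ! b # Q" "es ! c" R Z S]
      vol_exchange[of P "es ! b" Q Z "R @ es ! c # S"] m upd'' abc by (simp add: vol_replace)
  let ?T = "\<lambda>I. \<phi> (nths es I) * vol (nths es I @ Z # nths es (- {a, b, c}))"
  let ?J = "{I. I \<subseteq> {..<m} \<and> card I + length (Z # nths es (- {a, b, c})) = m}"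
  have len_omit: "length (Z # nths es (- {a, b, c})) + 2 = m"
    unfolding omit using m[of Z Z Z] by simp
  have pair: "nths es {i, j} = [es ! i, es ! j]" if "i < j" "j < m" for i j
  proof -
    define U V W where "U = take i es" and "V = take (j - Suc i) (drop (Suc i) es)" and "W = drop (Suc j) es"
    have U: "length U = i" and V: "length V = j - Suc i"
      using that by (auto simp: U_def V_def)
    have es': "es = U @ es ! i # V @ es ! j # W"
      using that id_take_nth_drop[of i es] id_take_nth_drop[of "j - Suc i" "drop (Suc i) es"]
      by (simp add: U_def V_def W_def)
    have j: "j = length U + length V + 1" using U V that by simp
    show ?thesis
      unfolding U[symmetric] j using nths_pair[of U "es ! i" V "es ! j" W] U j es' by simp
  qed
  have "hodge_star g es \<phi> (Z # nths es (- {a, b, c})) = sum ?T ?J"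
    by (simp add: hodge_star_def)
  also have "\<dots> = sum ?T {{a, b}, {a, c}, {b, c}}"
  proof (rule sum.mono_neutral_right)
    show "finite ?J" by (rule finite_subset[of _ "Pow {..<m}"]) auto
    show "{{a, b}, {a, c}, {b, c}} \<subseteq> ?J"
      using abc len_omit by auto
    show "\<forall>I \<in> ?J - {{a, b}, {a, c}, {b, c}}. ?T I = 0"
    proof
      fix I assume I: "I \<in> ?J - {{a, b}, {a, c}, {b, c}}"
      then have I2: "card I = 2" "I \<subseteq> {..<m}" using len_omit by auto
      then obtain i j where ij: "I = {i, j}" "i \<noteq> j" by (auto simp: card_2_iff)
      have "\<not> I \<subseteq> {a, b, c}"
        using I ij by auto
      then obtain l where l: "l \<in> I" "l \<notin> {a, b, c}" by auto
      then have "es ! l \<in> set (nths es I)" "es ! l \<in> set (nths es (- {a, b, c}))"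
        using I2 by (auto simp: set_nths)
      then have nd: "\<not> distinct (nths es I @ Z # nths es (- {a, b, c}))" by auto
      have "{i. i < m \<and> i \<in> I} = I" using I2 by auto
      then have "length (nths es I) = 2" using I2 by (simp add: length_nths)
      then have "vol (nths es I @ Z # nths es (- {a, b, c})) = 0"
        using nd len_omit by (intro vol_not_distinct) auto
      then show "?T I = 0" by simp
    qed
  qed
  also have "\<dots> = ?T {a, b} + ?T {a, c} + ?T {b, c}"
    using abc by (simp add: doubleton_eq_iff)
  finally show ?thesis
    using abc by (simp add: pair omit front vab vac vbc algebra_simps)
qed

end

section \<open>The differential on a list with one entry omitted\<close>

lemma nth_nths_omit:
  assumes "k < length Xs" "i < length Xs - 1"
  shows "nths Xs (- {k}) ! i = Xs ! (if i < k then i else Suc i)"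
proof -
  obtain P x R where Xs: "Xs = P @ x # R" and P: "length P = k"
    using id_take_nth_drop[OF assms(1)] assms(1) by (metis length_take min.absorb4)
  have "nths Xs (- {k}) = P @ R"
    unfolding Xs P[symmetric] by (simp add: nths_append nths_Cons nths_all)
  then show ?thesis
    using P by (simp add: Xs nth_append)
qed

lemma length_nths_omit:
  assumes "k < length Xs"
  shows "length (nths Xs (- {k})) = length Xs - 1"
proof -
  have "{i. i < length Xs \<and> i \<in> - {k}} = {..<length Xs} - {k}" by auto
  then show ?thesis using assms by (simp add: length_nths)
qed

text \<open>\<open>s\<close> turns positions in the list without entry \<open>k\<close> into
  positions in the original list.\<close>

lemma nths_omit_twice:
  fixes k :: nat
  defines "s \<equiv> \<lambda>i. if i < k then i else Suc i"
  shows "nths (nths Xs (- {k})) (- {i, j}) = nths Xs (- {s i, s j, k})"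
proof -
  have card: "card {l' \<in> - {k}. l' < l} = (if k < l then l - 1 else l)" for l
  proof -
    have "{l' \<in> - {k}. l' < l} = {..<l} - {k}" by auto
    then show ?thesis by auto
  qed
  have "{l \<in> - {k}. \<exists>j'\<in> - {i, j}. card {l' \<in> - {k}. l' < l} = j'} = - {s i, s j, k}"
    unfolding card s_def by auto
  then show ?thesis
    unfolding nths_nths by simp
qed

text \<open>
  The sign with \<open>of_bool\<close> accounts for the positions beyond \<open>k\<close> moving down by one. It is also the sign of
  sorting \<open>(i, j, k)\<close> in \<open>hodge_star_omit3\<close>, so the two cancel in \<open>ce_d_hodge_star_omit\<close>.
\<close>

lemma ce_d_omit:
  assumes k: "k < length Xs"
  shows "ce_d br \<phi> (nths Xs (- {k})) =
    (\<Sum>j<length Xs. \<Sum>i<j. if i = k \<or> j = k then 0 else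
       (- 1) ^ (i + j) * (- 1) ^ (of_bool (k < i) + of_bool (k < j)) *
       \<phi> (br (Xs ! i) (Xs ! j) # nths Xs (- {i, j, k})))"
proof -
  \<comment> \<open>\<open>s\<close> skips position \<open>k\<close> and \<open>t\<close> inverts it
    away from \<open>k\<close>; the pair reindexes the double sum.\<close>
  define s where "s = (\<lambda>i. if i < k then i else Suc i)"
  define t where "t = (\<lambda>i. if i < k then i else i - 1)"
  let ?F = "\<lambda>i j. (- 1) ^ (i + j) * (- 1) ^ (of_bool (k < i) + of_bool (k < j)) *
       \<phi> (br (Xs ! i) (Xs ! j) # nths Xs (- {i, j, k}))"
  let ?S = "SIGMA j:{..<length Xs}. {..<j}" and ?S' = "SIGMA j:{..<length Xs - 1}. {..<j}"
  let ?K = "{(j, i). j < length Xs \<and> i < j \<and> i \<noteq> k \<and> j \<noteq> k}"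
  have "ce_d br \<phi> (nths Xs (- {k})) = (\<Sum>(j, i)\<in>?S'. (- 1) ^ (i + j) *
      \<phi> (br (nths Xs (- {k}) ! i) (nths Xs (- {k}) ! j) # nths (nths Xs (- {k})) (- {i, j})))"
    by (simp add: ce_d_def length_nths_omit[OF k] sum.Sigma)
  also have "\<dots> = (\<Sum>(j, i)\<in>?S'. ?F (s i) (s j))"
  proof (intro sum.cong refl, clarify)
    fix j i assume ji: "j < length Xs - 1" "i < j"
    have "(- 1) ^ (s i + s j) * (- 1) ^ (of_bool (k < s i) + of_bool (k < s j)) = ((- 1) ^ (i + j) :: real)"
      by (auto simp: s_def)
    moreover have "nths Xs (- {k}) ! i = Xs ! s i" "nths Xs (- {k}) ! j = Xs ! s j"
      using ji k by (auto simp: s_def nth_nths_omit)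
    moreover have "nths (nths Xs (- {k})) (- {i, j}) = nths Xs (- {s i, s j, k})"
      unfolding s_def by (rule nths_omit_twice)
    ultimately show "(- 1) ^ (i + j) *
      \<phi> (br (nths Xs (- {k}) ! i) (nths Xs (- {k}) ! j) # nths (nths Xs (- {k})) (- {i, j})) = ?F (s i) (s j)"
      by simp
  qed
  also have "\<dots> = (\<Sum>(j, i)\<in>?K. ?F i j)"
  proof (rule sum.reindex_bij_witness[where i = "\<lambda>(j, i). (t j, t i)" and j = "\<lambda>(j, i). (s j, s i)"])
  qed (use k in \<open>auto simp: s_def t_def split: if_splits\<close>)
  also have "\<dots> = (\<Sum>(j, i)\<in>?S. if i = k \<or> j = k then 0 else ?F i j)"
    by (rule sum.mono_neutral_cong_left) (auto split: if_splits)
  finally show ?thesis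
    by (simp add: sum.Sigma)
qed

section \<open>The operator star d star on 2-forms\<close>

context orthonormal_frame
begin

lemma linear_expand:
  assumes "linear L"
  shows "(\<Sum>i<m. g x (es ! i) *\<^sub>R L (es ! i)) = L x"
proof -
  have "L x = L (\<Sum>i<m. g x (es ! i) *\<^sub>R es ! i)"
    by (simp add: expand)
  also have "\<dots> = (\<Sum>i<m. g x (es ! i) *\<^sub>R L (es ! i))"
    by (simp add: linear_sum[OF assms] linear_scale[OF assms])
  finally show ?thesis by simp
qed

lemma linear_expand_real:
  fixes L :: "'a \<Rightarrow> real"
  assumes "linear L"
  shows "(\<Sum>i<m. g x (es ! i) * L (es ! i)) = L x"
  using linear_expand[OF assms, of x] by simp

text \<open>For skew \<open>w\<close>, this is the wedge product of \<open>w\<close> with the 1-form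
  dual to \<open>Z\<close>, evaluated on three frame vectors.\<close>

definition "alt3 w i j k Z = w (es ! i) (es ! j) * g (es ! k) Z
   + w (es ! j) (es ! k) * g (es ! i) Z + w (es ! k) (es ! i) * g (es ! j) Z"

lemma alt3_swap:
  assumes "\<And>x y. w x y = - w y x"
  shows "alt3 w i k j Z = - alt3 w i j k Z" "alt3 w j i k Z = - alt3 w i j k Z"
  unfolding alt3_def
  using assms[of "es ! i" "es ! j"] assms[of "es ! j" "es ! k"] assms[of "es ! k" "es ! i"]
  by (simp_all add: algebra_simps)

lemma alt3_degenerate:
  assumes "\<And>x y. w x y = - w y x"
  shows "k = i \<or> k = j \<Longrightarrow> alt3 w i j k Z = 0"
  unfolding alt3_def using assms[of "es ! i" "es ! j"] assms[of "es ! i" "es ! i"] assms[of "es ! j" "es ! j"]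
  by auto

text \<open>\<open>hodge_star_codim2\<close> treats sorted indices; antisymmetry of
  \<open>alt3\<close> moves \<open>k\<close> to any other position.\<close>

lemma hodge_star_omit3:
  fixes w :: "'a \<Rightarrow> 'a \<Rightarrow> real"
  assumes w: "\<And>x y. w x y = - w y x" and \<phi>: "\<And>x y. \<phi> [x, y] = w x y"
    and ijk: "i < j" "j < m" "k < m" "i \<noteq> k" "j \<noteq> k"
  shows "hodge_star g es \<phi> (Z # nths es (- {i, j, k})) =
    (- 1) ^ (i + j + k + 1) * (- 1) ^ (of_bool (k < i) + of_bool (k < j)) * alt3 w i j k Z"
proof -
  have sorted: "hodge_star g es \<phi> (Z # nths es (- {a, b, c})) = (- 1) ^ (a + b + c + 1) * alt3 w a b c Z"
    if "a < b" "b < c" "c < m" for a b c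
    unfolding hodge_star_codim2[OF that] \<phi> alt3_def
    using w[of "es ! c" "es ! a"] by (simp add: algebra_simps)
  consider "k < i" | "i < k" "k < j" | "j < k" using ijk by linarith
  then show ?thesis
  proof cases
    case 1
    have "{i, j, k} = {k, i, j}" by auto
    then show ?thesis
      using sorted[of k i j] 1 ijk alt3_swap[where w = w, OF w, of i k j Z] alt3_swap[where w = w, OF w, of k i j Z]
      by (simp add: power_add mult_ac)
  next
    case 2
    have "{i, j, k} = {i, k, j}" by auto
    then show ?thesis
      using sorted[of i k j] 2 ijk alt3_swap[where w = w, OF w, of i k j Z]
      by (simp add: power_add mult_ac)
  next
    case 3
    then show ?thesis
      using sorted[of i j k] ijk by (simp add: power_add mult_ac)
  qed
qed

lemma ce_d_hodge_star_omit:
  fixes w :: "'a \<Rightarrow> 'a \<Rightarrow> real"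
  assumes w: "\<And>x y. w x y = - w y x" and \<phi>: "\<And>x y. \<phi> [x, y] = w x y" and k: "k < m"
  shows "ce_d br (hodge_star g es \<phi>) (nths es (- {k})) =
    (- 1) ^ (k + 1) * (\<Sum>j<m. \<Sum>i<j. alt3 w i j k (br (es ! i) (es ! j)))"
  unfolding ce_d_omit[OF k] sum_distrib_left
proof (intro sum.cong refl)
  fix j i assume "j \<in> {..<m}" "i \<in> {..<j}"
  then have ij: "i < j" "j < m" by auto
  show "(if i = k \<or> j = k then 0
        else (- 1) ^ (i + j) * (- 1) ^ (of_bool (k < i) + of_bool (k < j)) *
             hodge_star g es \<phi> (br (es ! i) (es ! j) # nths es (- {i, j, k}))) =
       (- 1) ^ (k + 1) * alt3 w i j k (br (es ! i) (es ! j))"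
  proof (cases "i = k \<or> j = k")
    case True
    \<comment> \<open>The terms excluded by \<open>ce_d_omit\<close> may be restored, because
      \<open>alt3\<close> vanishes on a repeated index.\<close>
    then show ?thesis using alt3_degenerate[where w = w, OF w, of k i j] by auto
  next
    case False
    let ?s = "(- 1) ^ (i + j) * (- 1) ^ (of_bool (k < i) + of_bool (k < j)) :: real"
    have "?s * ?s = 1"
      by (simp flip: power_add)
    then have cancel: "?s * (?s * c) = c" for c
      by (simp flip: mult.assoc)
    have "hodge_star g es \<phi> (br (es ! i) (es ! j) # nths es (- {i, j, k})) =
        ?s * ((- 1) ^ (k + 1) * alt3 w i j k (br (es ! i) (es ! j)))"
      using False hodge_star_omit3[where w = w, OF w \<phi> ij k, of "br (es ! i) (es ! j)"]
      by (simp add: power_add)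
    then show ?thesis
      using False by (simp only: cancel if_False)
  qed
qed

text \<open>Summing over the omitted index \<open>k\<close> collapses frame expansions. What remains
  is symmetric in \<open>i\<close>, \<open>j\<close> and zero on the diagonal, so the factor 2
  replaces the sum over \<open>i < j\<close> by the full double sum.\<close>

lemma hodge_d_hodge:
  fixes w :: "'a \<Rightarrow> 'a \<Rightarrow> real"
  assumes w: "\<And>x y. w x y = - w y x" and \<phi>: "\<And>x y. \<phi> [x, y] = w x y" and bw: "bilinear w"
    and br: "bilinear br" "\<And>x. br x x = 0"
  shows "2 * hodge_star g es (ce_d br (hodge_star g es \<phi>)) [Y] =
    (- 1) ^ m * ((\<Sum>i<m. \<Sum>j<m. w (es ! i) (es ! j) * g (br (es ! i) (es ! j)) Y)
      + 2 * (\<Sum>i<m. \<Sum>j<m. w Y (es ! i) * g (br (es ! i) (es ! j)) (es ! j)))"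
proof -
  define T where "T = (\<lambda>i j. w (es ! i) (es ! j) * g (br (es ! i) (es ! j)) Y
     + w (es ! j) Y * g (br (es ! i) (es ! j)) (es ! i) + w Y (es ! i) * g (br (es ! i) (es ! j)) (es ! j))"
  have br_anti: "br x y = - br y x" for x y
  proof -
    have "br (x + y) (x + y) = br x x + br y y + br x y + br y x"
      by (simp add: bilinear_ladd[OF br(1)] bilinear_radd[OF br(1)])
    then show ?thesis by (simp add: br(2) eq_neg_iff_add_eq_0)
  qed
  have g_neg: "g (- x) y = - g x y" for x y
    using bilinear_lneg[OF g_bilinear] by simp
  \<comment> \<open>Each of the three summands of \<open>alt3\<close> contains \<open>e_k\<close>
    once besides \<open>g e_k Y\<close>, so the sum over \<open>k\<close> puts \<open>Y\<close> in
    its place.\<close>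
  have alt: "(\<Sum>k<m. g (es ! k) Y * alt3 w i j k Z) = w (es ! i) (es ! j) * g Z Y
     + w (es ! j) Y * g Z (es ! i) + w Y (es ! i) * g Z (es ! j)" for i j Z
  proof -
    have 1: "(\<Sum>k<m. g Y (es ! k) * g Z (es ! k)) = g Z Y"
      by (rule linear_expand_real) (use g_bilinear in \<open>simp add: bilinear_def\<close>)
    have 2: "(\<Sum>k<m. g Y (es ! k) * w (es ! j) (es ! k)) = w (es ! j) Y"
      by (rule linear_expand_real) (use bw in \<open>simp add: bilinear_def\<close>)
    have 3: "(\<Sum>k<m. g Y (es ! k) * w (es ! k) (es ! i)) = w Y (es ! i)"
      by (rule linear_expand_real) (use bw in \<open>simp add: bilinear_def\<close>)
    have "(\<Sum>k<m. g (es ! k) Y * alt3 w i j k Z) =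
      w (es ! i) (es ! j) * (\<Sum>k<m. g Y (es ! k) * g Z (es ! k))
      + g Z (es ! i) * (\<Sum>k<m. g Y (es ! k) * w (es ! j) (es ! k))
      + g Z (es ! j) * (\<Sum>k<m. g Y (es ! k) * w (es ! k) (es ! i))"
      unfolding alt3_def sum_distrib_left sum.distrib[symmetric]
      by (intro sum.cong refl) (simp add: algebra_simps g_sym[of Y] g_sym[of Z])
    then show ?thesis unfolding 1 2 3 by (simp add: mult_ac)
  qed
  have swap: "(\<Sum>k<m. g (es ! k) Y * (\<Sum>j<m. \<Sum>i<j. alt3 w i j k (br (es ! i) (es ! j)))) =
    (\<Sum>j<m. \<Sum>i<j. \<Sum>k<m. g (es ! k) Y * alt3 w i j k (br (es ! i) (es ! j)))"
    unfolding sum_distrib_left by (subst sum.swap) (intro sum.cong refl sum.swap)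
  have "hodge_star g es (ce_d br (hodge_star g es \<phi>)) [Y] =
    (\<Sum>k<m. (- 1) ^ m * (g (es ! k) Y * (\<Sum>j<m. \<Sum>i<j. alt3 w i j k (br (es ! i) (es ! j)))))"
    unfolding hodge_star_codim1
  proof (intro sum.cong refl)
    fix k assume "k \<in> {..<m}"
    then have k: "k < m" by simp
    \<comment> \<open>The sign of the differential and that of \<open>hodge_star_codim1\<close>
      combine to one independent of \<open>k\<close>.\<close>
    then have eq: "(- 1) ^ (k + 1) * (- 1) ^ (m - 1 - k) = ((- 1) ^ m :: real)"
      by (cases m) (simp_all flip: power_add)
    show "ce_d br (hodge_star g es \<phi>) (nths es (- {k})) * ((- 1) ^ (m - 1 - k) * g (es ! k) Y) =
      (- 1) ^ m * (g (es ! k) Y * (\<Sum>j<m. \<Sum>i<j. alt3 w i j k (br (es ! i) (es ! j))))"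
      unfolding ce_d_hodge_star_omit[where w = w, OF w \<phi> k] eq[symmetric] by (simp only: mult_ac)
  qed
  also have "\<dots> = (- 1) ^ m * (\<Sum>j<m. \<Sum>i<j. \<Sum>k<m. g (es ! k) Y * alt3 w i j k (br (es ! i) (es ! j)))"
    unfolding sum_distrib_left[symmetric] swap ..
  also have "\<dots> = (- 1) ^ m * (\<Sum>j<m. \<Sum>i<j. T i j)"
    by (simp add: alt T_def)
  finally have star: "hodge_star g es (ce_d br (hodge_star g es \<phi>)) [Y] = (- 1) ^ m * (\<Sum>j<m. \<Sum>i<j. T i j)" .
  have T_sym: "T j i = T i j" for i j
    unfolding T_def
    using br_anti[of "es ! i" "es ! j"] w[of "es ! i" "es ! j"] w[of "es ! j" Y] w[of "es ! i" Y]
    by (simp add: g_neg)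
  have T_diag: "T i i = 0" for i
    using br(2) bilinear_lzero[OF g_bilinear] by (simp add: T_def)
  have split: "(\<Sum>i<n. \<Sum>j<n. T i j) = 2 * (\<Sum>j<n. \<Sum>i<j. T i j)" for n
  proof (induction n)
    case (Suc n)
    have "(\<Sum>i<n. T n i) = (\<Sum>i<n. T i n)" by (simp add: T_sym)
    then show ?case using Suc by (simp add: sum.distrib T_diag)
  qed simp
  \<comment> \<open>The last two summands of \<open>T\<close> are interchanged by swapping
    \<open>i\<close> and \<open>j\<close>, hence contribute equally.\<close>
  have "(\<Sum>i<m. \<Sum>j<m. w (es ! j) Y * g (br (es ! i) (es ! j)) (es ! i)) =
      (\<Sum>j<m. \<Sum>i<m. w (es ! j) Y * g (br (es ! i) (es ! j)) (es ! i))"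
    by (rule sum.swap)
  also have "\<dots> = (\<Sum>i<m. \<Sum>j<m. w Y (es ! i) * g (br (es ! i) (es ! j)) (es ! j))"
  proof (intro sum.cong refl)
    fix i j
    show "w (es ! i) Y * g (br (es ! j) (es ! i)) (es ! j) = w Y (es ! i) * g (br (es ! i) (es ! j)) (es ! j)"
      using br_anti[of "es ! i" "es ! j"] w[of "es ! i" Y] by (simp add: g_neg)
  qed
  finally have "(\<Sum>i<m. \<Sum>j<m. T i j) =
    (\<Sum>i<m. \<Sum>j<m. w (es ! i) (es ! j) * g (br (es ! i) (es ! j)) Y)
      + 2 * (\<Sum>i<m. \<Sum>j<m. w Y (es ! i) * g (br (es ! i) (es ! j)) (es ! j))"
    by (simp add: T_def sum.distrib)
  then show ?thesis
    using split[of m] unfolding star by simp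
qed

text \<open>For \<open>w = g(J x, y)\<close> one further index sums out in each term, leaving the
  vector \<Sum> \<open>[e_i, J e_i]\<close> and the trace of \<open>ad\<close> at
  \<open>J Y\<close>.\<close>

lemma hodge_star_fundamental_form:
  assumes J: "linear J" "\<And>x. J (J x) = - x" "\<And>x y. g (J x) (J y) = g x y"
    and br: "bilinear br" "\<And>x. br x x = 0"
  shows "2 * hodge_star g es (ce_d br (hodge_star g es (fundamental_form J g))) [Y] =
    (- 1) ^ m * ((\<Sum>i<m. g (br (es ! i) (J (es ! i))) Y) + 2 * (\<Sum>i<m. g (br (J Y) (es ! i)) (es ! i)))"
proof -
  let ?w = "\<lambda>x y. g (J x) y"
  have w: "?w x y = - ?w y x" for x y
    using J(3)[of "J x" y] g_sym[of x "J y"] by (simp add: J(2) bilinear_lneg[OF g_bilinear])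
  have lin_g: "linear (g z)" "linear (\<lambda>x. g x z)" for z
    using g_bilinear by (simp_all add: bilinear_def)
  have lin_br: "linear (br z)" "linear (\<lambda>x. br x z)" for z
    using br by (simp_all add: bilinear_def)
  have bw: "bilinear ?w"
    unfolding bilinear_def using lin_g linear_compose[OF J(1) lin_g(2)] by (auto simp: o_def)
  have 1: "(\<Sum>j<m. g (J (es ! i)) (es ! j) * g (br (es ! i) (es ! j)) Y) = g (br (es ! i) (J (es ! i))) Y" for i
    by (rule linear_expand_real) (use linear_compose[OF lin_br(1) lin_g(2)] in \<open>auto simp: o_def\<close>)
  have 2: "(\<Sum>i<m. g (J Y) (es ! i) * g (br (es ! i) (es ! j)) (es ! j)) = g (br (J Y) (es ! j)) (es ! j)" for j
    by (rule linear_expand_real) (use linear_compose[OF lin_br(2) lin_g(2)] in \<open>auto simp: o_def\<close>)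
  have "2 * hodge_star g es (ce_d br (hodge_star g es (fundamental_form J g))) [Y] =
    (- 1) ^ m * ((\<Sum>i<m. \<Sum>j<m. g (J (es ! i)) (es ! j) * g (br (es ! i) (es ! j)) Y)
      + 2 * (\<Sum>i<m. \<Sum>j<m. g (J Y) (es ! i) * g (br (es ! i) (es ! j)) (es ! j)))"
    by (rule hodge_d_hodge[where w = ?w, OF w _ bw br]) (simp add: fundamental_form_def)
  moreover have "(\<Sum>i<m. \<Sum>j<m. g (J Y) (es ! i) * g (br (es ! i) (es ! j)) (es ! j)) =
    (\<Sum>j<m. g (br (J Y) (es ! j)) (es ! j))"
    by (subst sum.swap) (simp add: 2)
  ultimately show ?thesis
    by (simp add: 1)
qed

end

section \<open>Existence of unitary bases\<close>

lemma finite_dimensional_basis: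
  assumes "\<exists>B::'a::real_vector set. finite B \<and> span B = UNIV"
  obtains B :: "'a::real_vector set" where "finite B" "span B = UNIV" "card B = dim (UNIV :: 'a::real_vector set)"
proof -
  obtain C :: "'a::real_vector set" where C: "finite C" "span C = UNIV" using assms by auto
  obtain B :: "'a::real_vector set" where B: "independent B" "UNIV \<subseteq> span B" "card B = dim (UNIV :: 'a::real_vector set)"
    using real_vector.basis_exists[of "UNIV :: 'a::real_vector set"] by metis
  have "finite B"
    using real_vector.independent_span_bound[OF C(1) B(1)] C(2) by auto
  with B that show ?thesis by auto
qed

lemma independent_card_le_dim:
  assumes "\<exists>B::'a::real_vector set. finite B \<and> span B = UNIV" and "independent (S :: 'a::real_vector set)"
  shows "finite S \<and> card S \<le> dim (UNIV :: 'a::real_vector set)"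
proof -
  obtain B :: "'a::real_vector set" where "finite B" "span B = UNIV" "card B = dim (UNIV :: 'a::real_vector set)"
    by (rule finite_dimensional_basis[OF assms(1)])
  then show ?thesis
    using real_vector.independent_span_bound[of B S] assms(2) by auto
qed

lemma span_eq_UNIV_if_card:
  assumes fin: "\<exists>B::'a::real_vector set. finite B \<and> span B = UNIV"
    and S: "independent (S :: 'a::real_vector set)" "card S = dim (UNIV :: 'a::real_vector set)"
  shows "span S = UNIV"
proof (rule ccontr)
  assume "span S \<noteq> UNIV"
  then obtain x where x: "x \<notin> span S" by auto
  then have "x \<notin> S" using real_vector.span_base by metis
  moreover have "independent (insert x S)"
    using x S(1) by (rule real_vector.independent_insertI)
  ultimately show False
    using independent_card_le_dim[OF fin, of "insert x S"] S(2) by auto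
qed

definition orthonormal_list :: "('a \<Rightarrow> 'a \<Rightarrow> real) \<Rightarrow> 'a list \<Rightarrow> bool" where
  "orthonormal_list g es \<longleftrightarrow>
     (\<forall>i<length es. \<forall>j<length es. g (es ! i) (es ! j) = (if i = j then 1 else 0))"

lemma inner_product_linear:
  assumes "inner_product g"
  shows "linear (g z)" "linear (\<lambda>x. g x z)"
  using assms by (simp_all add: inner_product_def bilinear_def)

lemma inner_product_sym: "inner_product g \<Longrightarrow> g x y = g y x"
  by (simp add: inner_product_def)

lemma inner_product_sum_coeff:
  assumes g: "inner_product g" and on: "orthonormal_list g es" and k: "k < length es"
  shows "g (\<Sum>i<length es. c i *\<^sub>R es ! i) (es ! k) = c k"
proof -
  have "g (\<Sum>i<length es. c i *\<^sub>R es ! i) (es ! k) = (\<Sum>i<length es. c i * g (es ! i) (es ! k))"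
    by (simp add: linear_sum[OF inner_product_linear(2)[OF g]] linear_scale[OF inner_product_linear(2)[OF g]])
  also have "\<dots> = (\<Sum>i<length es. if i = k then c k else 0)"
    using on k by (intro sum.cong) (auto simp: orthonormal_list_def)
  finally show ?thesis using k by simp
qed

lemma orthonormal_list_expand:
  assumes g: "inner_product g" and on: "orthonormal_list g es" and x: "x \<in> span (set es)"
  shows "(\<Sum>i<length es. g x (es ! i) *\<^sub>R es ! i) = x"
  using x
proof (rule span_induct)
  have *: "linear (\<lambda>x. g x z)" for z by (rule inner_product_linear(2)[OF g])
  show "subspace {x. (\<Sum>i<length es. g x (es ! i) *\<^sub>R es ! i) = x}"
    by (auto simp: subspace_def linear_0[OF *] linear_add[OF *] linear_scale[OF *]
        scaleR_add_left sum.distrib scaleR_sum_right[symmetric] scaleR_scaleR[symmetric] simp del: scaleR_scaleR)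
  fix x assume "x \<in> set es"
  then obtain k where k: "k < length es" "x = es ! k" by (auto simp: in_set_conv_nth)
  have "(\<Sum>i<length es. g x (es ! i) *\<^sub>R es ! i) = (\<Sum>i<length es. if i = k then es ! k else 0)"
    using on k by (intro sum.cong) (auto simp: orthonormal_list_def)
  then show "(\<Sum>i<length es. g x (es ! i) *\<^sub>R es ! i) = x"
    using k by simp
qed

lemma orthonormal_list_independent:
  assumes g: "inner_product g" and on: "orthonormal_list g es"
  shows "independent (set es)" "card (set es) = length es"
proof -
  have "distinct es"
    using on unfolding orthonormal_list_def distinct_conv_nth by (metis zero_neq_one)
  then show "card (set es) = length es" by (rule distinct_card)
  show "independent (set es)"
  proof
    assume "dependent (set es)"
    then obtain a where a: "a \<in> set es" "a \<in> span (set es - {a})"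
      by (auto simp: dependent_def)
    have ortho: "g x y = (if x = y then 1 else 0)" if "x \<in> set es" "y \<in> set es" for x y
      using that on \<open>distinct es\<close> by (auto simp: in_set_conv_nth orthonormal_list_def nth_eq_iff_index_eq)
    have *: "linear (\<lambda>x. g x a)" by (rule inner_product_linear(2)[OF g])
    from a(2) have "g a a = 0"
    proof (rule span_induct[where P = "\<lambda>x. g x a = 0"])
      show "subspace {x. g x a = 0}"
        by (simp add: subspace_def linear_0[OF *] linear_add[OF *] linear_scale[OF *])
    qed (use a(1) ortho in auto)
    then show False using ortho[OF a(1) a(1)] by simp
  qed
qed

lemma orthonormal_frame_of_card:
  assumes fin: "\<exists>B::'a::real_vector set. finite B \<and> span B = UNIV"
    and g: "inner_product g" and on: "orthonormal_list g (es :: 'a::real_vector list)" and len: "length es = dim (UNIV :: 'a::real_vector set)"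
  shows "orthonormal_frame g es"
proof
  show "inner_product g" by (rule g)
  show "g (es ! i) (es ! j) = (if i = j then 1 else 0)" if "i < length es" "j < length es" for i j
    using that on by (simp add: orthonormal_list_def)
  have "span (set es) = UNIV"
    using orthonormal_list_independent[OF g on] len by (intro span_eq_UNIV_if_card[OF fin]) simp_all
  then show "(\<Sum>i<length es. g x (es ! i) *\<^sub>R es ! i) = x" for x
    using orthonormal_list_expand[OF g on] by auto
qed

text \<open>A longest orthonormal list of pairs \<open>u, J u\<close> must span: otherwise the
  normalised orthogonal remainder of a missed vector gives another pair.\<close>

lemma exists_unitary_basis:
  assumes fin: "\<exists>B::'a::real_vector set. finite B \<and> span B = UNIV"
    and J: "linear J" "\<And>x::'a::real_vector. J (J x) = - x" and h: "hermitian_metric J g"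
  shows "\<exists>es. unitary_basis J g es"
proof -
  have g: "inner_product g" and gJ: "\<And>x y. g (J x) (J y) = g x y"
    using h by (auto simp: hermitian_metric_def)
  note lin = inner_product_linear[OF g]
  define P where "P es \<longleftrightarrow> orthonormal_list g es \<and> even (length es) \<and>
    (\<forall>i. 2 * i + 1 < length es \<longrightarrow> es ! (2 * i + 1) = J (es ! (2 * i)))" for es
  have "P []" by (simp add: P_def orthonormal_list_def)
  moreover have "length es \<le> dim (UNIV :: 'a::real_vector set)" if "P es" for es
    using that orthonormal_list_independent[OF g, of es] independent_card_le_dim[OF fin, of "set es"]
    by (simp add: P_def)
  ultimately obtain es where es: "P es" and max: "\<And>xs. P xs \<Longrightarrow> length xs \<le> length es"
    using ex_has_greatest_nat[of P "[]" length "dim (UNIV :: 'a::real_vector set) + 1"]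
    by (force simp: less_Suc_eq_le)
  have on: "orthonormal_list g es" using es by (simp add: P_def)
  have "span (set es) = UNIV"
  proof (rule ccontr)
    assume "span (set es) \<noteq> UNIV"
    then obtain x where x: "x \<notin> span (set es)" by auto
    define p where "p = (\<Sum>i<length es. g x (es ! i) *\<^sub>R es ! i)"
    define y where "y = x - p"
    have "p \<in> span (set es)"
      unfolding p_def by (intro span_sum span_scale span_base) auto
    then have "y \<noteq> 0" using x by (auto simp: y_def)
    then have pos: "g y y > 0" using g by (simp add: inner_product_def)
    define u where "u = (1 / sqrt (g y y)) *\<^sub>R y"
    have uu: "g u u = 1"
      using pos by (simp add: u_def linear_scale[OF lin(1)] linear_scale[OF lin(2)])
    have ue: "g u (es ! k) = 0" if "k < length es" for k
      using inner_product_sum_coeff[OF g on that, of "\<lambda>i. g x (es ! i)"]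
      by (simp add: u_def y_def p_def linear_scale[OF lin(2)] linear_diff[OF lin(2)])
    have move: "g (J a) b = - g a (J b)" for a b
      using gJ[of "J a" b] by (simp add: J(2) linear_neg[OF lin(2)])
    \<comment> \<open>\<open>J\<close> maps an even entry to its successor, and an odd entry is the
      image of its predecessor; both cases reduce to orthogonality of \<open>u\<close>.\<close>
    have Jue: "g (J u) (es ! k) = 0" if k: "k < length es" for k
    proof (cases "even k")
      case True
      then obtain i where i: "k = 2 * i" by blast
      have "2 * i + 1 < length es"
        using es k i by (metis P_def Suc_eq_plus1 Suc_lessI even_Suc even_mult_iff even_numeral)
      then have "J (es ! k) = es ! (2 * i + 1)" using es i by (simp add: P_def)
      then show ?thesis using ue \<open>2 * i + 1 < length es\<close> by (simp add: move)
    next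
      case False
      then obtain i where i: "k = 2 * i + 1" by (auto elim: oddE)
      then have "es ! k = J (es ! (2 * i))" using es k by (simp add: P_def)
      then show ?thesis using ue i k by (simp add: gJ)
    qed
    have uJu: "g u (J u) = 0"
      using move[of u u] inner_product_sym[OF g, of u "J u"] by simp
    \<comment> \<open>The length is even, so the new pair starts at an even position.\<close>
    obtain n where n: "length es = 2 * n" using es by (auto simp: P_def)
    have "P (es @ [u, J u])"
      unfolding P_def
    proof (intro conjI allI impI)
      show "even (length (es @ [u, J u]))" using es by (simp add: P_def)
      show "orthonormal_list g (es @ [u, J u])"
        unfolding orthonormal_list_def
        using on uu ue Jue uJu gJ[of u u] inner_product_sym[OF g]
        by (auto simp: nth_append nth_Cons' orthonormal_list_def less_Suc_eq)
      fix i assume "2 * i + 1 < length (es @ [u, J u])"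
      then consider "2 * i + 1 < length es" | "2 * i = length es"
        using n by force
      then show "(es @ [u, J u]) ! (2 * i + 1) = J ((es @ [u, J u]) ! (2 * i))"
        using es by cases (auto simp: P_def nth_append)
    qed
    then show False using max by fastforce
  qed
  then have "length es = dim (UNIV :: 'a::real_vector set)"
    using orthonormal_list_independent[OF g on]
      real_vector.dim_eq_card[of "set es" "UNIV :: 'a::real_vector set"] by simp
  then show ?thesis
    using es unfolding unitary_basis_def P_def orthonormal_list_def by blast
qed

section \<open>Traces in an orthonormal frame\<close>

context orthonormal_frame
begin

definition trace :: "('a \<Rightarrow> 'a) \<Rightarrow> real" where
  "trace L = (\<Sum>i<m. g (L (es ! i)) (es ! i))"

lemma linear_g: "linear (g z)" "linear (\<lambda>x. g x z)"
  using g_bilinear by (simp_all add: bilinear_def)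

text \<open>The Riesz representative of \<open>\<alpha>\<close>; it provides the normal of the ideal
  and the vector dual to the twisting form.\<close>

lemma dual_vector:
  assumes "linear \<alpha>"
  shows "g (\<Sum>i<m. \<alpha> (es ! i) *\<^sub>R es ! i) y = \<alpha> y"
proof -
  have "g (\<Sum>i<m. \<alpha> (es ! i) *\<^sub>R es ! i) y = (\<Sum>i<m. g y (es ! i) * \<alpha> (es ! i))"
    by (simp add: linear_sum[OF linear_g(2)] linear_scale[OF linear_g(2)] g_sym[of y] mult.commute)
  then show ?thesis using linear_expand_real[OF assms] by simp
qed

text \<open>Each frame is expanded in the other. This carries the trace of \<open>ad\<close> from
  the balanced metric to the twisted SKT metric.\<close>

lemma trace_basis_independent:
  assumes h: "orthonormal_frame h fs" and L: "linear L"
  shows "trace L = orthonormal_frame.trace h fs L"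
proof -
  interpret h: orthonormal_frame h fs by (rule h)
  have 1: "g (L (es ! i)) (es ! i) = (\<Sum>j<h.m. h (es ! i) (fs ! j) * g (L (fs ! j)) (es ! i))" for i
    using linear_compose[OF L linear_g(2)] by (subst h.linear_expand_real) (auto simp: o_def)
  have 2: "(\<Sum>i<m. g (L x) (es ! i) * h (es ! i) y) = h (L x) y" for x y
    by (rule linear_expand_real[OF h.linear_g(2)])
  have "trace L = (\<Sum>j<h.m. \<Sum>i<m. g (L (fs ! j)) (es ! i) * h (es ! i) (fs ! j))"
    unfolding trace_def 1 by (subst sum.swap) (simp add: mult.commute)
  then show ?thesis by (simp add: 2 h.trace_def)
qed

text \<open>Let S = A + A^T. Summed over the frame, \<open>eq\<close> gives tr(SA) = -c tr(A) = 0.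
  As S is symmetric, tr(S^2) = 2 tr(SA) = 0, and this is the sum of the squared entries of
  S.\<close>

lemma skew_if_trace_zero:
  assumes A: "linear A" and tr: "trace A = 0"
    and eq: "\<And>x. 2 * (g (A (A x)) x + g (A x) (A x)) + c * (2 * g (A x) x) = 0"
  shows "g (A x) y + g x (A y) = 0"
proof -
  define S where "S x y = g (A x) y + g x (A y)" for x y
  have S_sym: "S x y = S y x" for x y
    by (simp add: S_def g_sym[of _ "A _"])
  have lin_S: "linear (S x)" "linear (\<lambda>x. S x y)" for x y
    unfolding S_def using linear_compose[OF A linear_g(1)] linear_compose[OF A linear_g(2)]
    by (auto intro!: linear_compose_add linear_g simp: o_def)
  have "(\<Sum>i<m. S (A (es ! i)) (es ! i)) = (\<Sum>i<m. - c * g (A (es ! i)) (es ! i))"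
  proof (intro sum.cong refl)
    fix i show "S (A (es ! i)) (es ! i) = - c * g (A (es ! i)) (es ! i)"
      using eq[of "es ! i"] by (simp add: S_def algebra_simps)
  qed
  then have "(\<Sum>i<m. S (A (es ! i)) (es ! i)) = 0"
    using tr by (simp add: trace_def sum_negf flip: sum_distrib_left)
  moreover have "S (A (es ! i)) (es ! i) = (\<Sum>j<m. g (A (es ! i)) (es ! j) * S (es ! j) (es ! i))" for i
    by (subst linear_expand_real[OF lin_S(2)]) simp
  ultimately have Q: "(\<Sum>i<m. \<Sum>j<m. g (A (es ! i)) (es ! j) * S (es ! j) (es ! i)) = 0"
    by simp
  have Q': "(\<Sum>i<m. \<Sum>j<m. g (A (es ! j)) (es ! i) * S (es ! i) (es ! j)) = 0"
    using Q by (subst sum.swap)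
  \<comment> \<open>One factor of each square is split into an entry of A and an entry of its
    transpose; the two resulting sums are \<open>Q\<close> and \<open>Q'\<close>.\<close>
  have "(\<Sum>i<m. \<Sum>j<m. (S (es ! i) (es ! j))\<^sup>2) =
      (\<Sum>i<m. \<Sum>j<m. g (A (es ! i)) (es ! j) * S (es ! j) (es ! i) + g (A (es ! j)) (es ! i) * S (es ! i) (es ! j))"
  proof (intro sum.cong refl)
    fix i j
    have "S (es ! i) (es ! j) = g (A (es ! i)) (es ! j) + g (A (es ! j)) (es ! i)"
      by (simp add: S_def g_sym[of _ "A _"])
    then show "(S (es ! i) (es ! j))\<^sup>2 =
        g (A (es ! i)) (es ! j) * S (es ! j) (es ! i) + g (A (es ! j)) (es ! i) * S (es ! i) (es ! j)"
      using S_sym[of "es ! i" "es ! j"] by (simp add: power2_eq_square algebra_simps)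
  qed
  also have "\<dots> = 0"
    by (simp add: sum.distrib Q Q')
  finally have zero: "S (es ! i) (es ! j) = 0" if "i < m" "j < m" for i j
    using that by (simp add: sum_nonneg_eq_0_iff sum_nonneg)
  have "S (es ! i) y = 0" if "i < m" for i
    using linear_expand_real[OF lin_S(1), where x = y] zero[OF that] by (metis (no_types, lifting) lessThan_iff mult_zero_right sum.neutral)
  then have "S x y = 0"
    using linear_expand_real[OF lin_S(2), where x = x] by (metis (no_types, lifting) lessThan_iff mult_zero_right sum.neutral)
  then show ?thesis by (simp add: S_def)
qed

end

section \<open>Almost abelian Lie algebras with a complex structure\<close>

text \<open>The ideal is encoded by a functional \<open>e\<close> with that kernel, so that
  membership becomes a linear equation; \<open>e_br\<close> places all brackets in it.\<close>

locale almost_abelian_complex =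
  fixes br :: "'a::real_vector \<Rightarrow> 'a \<Rightarrow> 'a" and J :: "'a \<Rightarrow> 'a" and e :: "'a \<Rightarrow> real"
  assumes br_bilinear: "bilinear br" and br_self: "br x x = 0"
    and e_linear: "linear e" and e_br: "e (br x y) = 0"
    and br_kernel: "e x = 0 \<Longrightarrow> e y = 0 \<Longrightarrow> br x y = 0"
    and e_surj: "\<exists>x. e x = 1"
    and complex: "complex_structure br J"
begin

lemma br_linear: "linear (br z)" "linear (\<lambda>x. br x z)"
  using br_bilinear by (simp_all add: bilinear_def)

lemma br_anti: "br x y = - br y x"
proof -
  have "br (x + y) (x + y) = br x x + br y y + br x y + br y x"
    by (simp add: bilinear_ladd[OF br_bilinear] bilinear_radd[OF br_bilinear])
  then show ?thesis by (simp add: br_self eq_neg_iff_add_eq_0)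
qed

lemma J_linear: "linear J" and JJ: "J (J x) = - x"
  using complex by (auto simp: complex_structure_def)

lemmas br_simps = linear_add[OF br_linear(1)] linear_add[OF br_linear(2)]
  linear_scale[OF br_linear(1)] linear_scale[OF br_linear(2)]
  linear_diff[OF br_linear(1)] linear_diff[OF br_linear(2)]
  linear_neg[OF br_linear(1)] linear_neg[OF br_linear(2)]
  linear_0[OF br_linear(1)] linear_0[OF br_linear(2)]

lemmas J_simps = linear_add[OF J_linear] linear_scale[OF J_linear] linear_diff[OF J_linear]
  linear_neg[OF J_linear] linear_0[OF J_linear] JJ

lemmas e_simps = linear_add[OF e_linear] linear_scale[OF e_linear] linear_diff[OF e_linear]
  linear_neg[OF e_linear] linear_0[OF e_linear] e_br

text \<open>Removing the \<open>E\<close>-components leaves two vectors of the abelian ideal, so the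
  whole bracket is determined by \<open>ad\<close> at \<open>E\<close>.\<close>

lemma br_formula:
  assumes E: "e E = 1"
  shows "br x y = e x *\<^sub>R br E y - e y *\<^sub>R br E x"
proof -
  have "br (x - e x *\<^sub>R E) (y - e y *\<^sub>R E) = 0"
    by (rule br_kernel) (simp_all add: e_simps E)
  then show ?thesis
    using br_anti[of x E] by (simp add: br_simps br_self algebra_simps)
qed

text \<open>In the integrability condition for \<open>E\<close> and \<open>x\<close> the brackets
  with \<open>J E\<close> vanish, since \<open>J E\<close>, \<open>x\<close> and \<open>J x\<close>
  all lie in the ideal.\<close>

lemma br_J_commute:
  assumes E: "e E = 1" "e (J E) = 0" and x: "e x = 0" "e (J x) = 0"
  shows "br E (J x) = J (br E x)"
proof -
  have "br (J E) (J x) - br E x - J (br (J E) x) - J (br E (J x)) = 0"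
    using complex by (simp add: complex_structure_def)
  moreover have "br (J E) (J x) = 0" "br (J E) x = 0"
    using E x by (simp_all add: br_kernel)
  ultimately have "- br E x = J (br E (J x))"
    by (simp add: J_simps algebra_simps)
  from arg_cong[OF this, of J] show ?thesis by (simp add: J_simps)
qed

lemma e_J_br:
  assumes "e E = 1" "e (J E) = 0" "e x = 0" "e (J x) = 0"
  shows "e (J (br E x)) = 0"
  using br_J_commute[OF assms] e_br by metis

section \<open>Hermitian metrics and the balanced condition\<close>

lemma hermitian_anti:
  assumes "hermitian_metric J g"
  shows "g (J x) y = - g x (J y)"
proof -
  have "g (J (J x)) (J y) = g (J x) y" "bilinear g"
    using assms by (auto simp: hermitian_metric_def inner_product_def)
  then show ?thesis by (simp add: JJ bilinear_lneg)
qed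

lemma hermitian_J_self:
  assumes "hermitian_metric J g"
  shows "g x (J x) = 0"
  using hermitian_anti[OF assms, of x x] assms by (auto simp: hermitian_metric_def inner_product_def)

text \<open>\<open>E\<close> is the Riesz representative \<open>s\<close> of \<open>e\<close>,
  rescaled to \<open>e E = 1\<close>; \<open>e (J E) = 0\<close> because \<open>s\<close> is
  orthogonal to \<open>J s\<close>.\<close>

lemma normal_vector:
  assumes h: "hermitian_metric J g" and frame: "orthonormal_frame g es"
  obtains E c where "e E = 1" "e (J E) = 0" "c > 0" "\<And>x. g E x = c * e x"
proof -
  interpret orthonormal_frame g es by (rule frame)
  define s where "s = (\<Sum>i<m. e (es ! i) *\<^sub>R es ! i)"
  have gs: "g s x = e x" for x unfolding s_def by (rule dual_vector[OF e_linear])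
  have "s \<noteq> 0"
    using e_surj gs linear_0[OF linear_g(2)] by (metis zero_neq_one)
  then have pos: "e s > 0"
    using inner gs[of s] by (auto simp: inner_product_def)
  have "g s (J s) = 0" by (rule hermitian_J_self[OF h])
  then have eJs: "e (J s) = 0" by (simp add: gs)
  show thesis
  proof (rule that)
    show "e ((1 / e s) *\<^sub>R s) = 1" using pos by (simp add: e_simps)
    show "e (J ((1 / e s) *\<^sub>R s)) = 0" using eJs by (simp add: e_simps J_simps)
    show "1 / e s > 0" using pos by simp
    show "g ((1 / e s) *\<^sub>R s) x = 1 / e s * e x" for x
      by (simp add: linear_scale[OF linear_g(2)] gs)
  qed
qed

text \<open>By \<open>br_formula\<close> the two sides differ by the rank-one map
  \<open>y \<mapsto> e y *\<^sub>R br E x\<close>, whose trace is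
  \<open>e (br E x) = 0\<close>.\<close>

lemma trace_ad:
  assumes frame: "orthonormal_frame g es" and E: "e E = 1"
  shows "orthonormal_frame.trace g es (br x) = e x * orthonormal_frame.trace g es (br E)"
proof -
  interpret orthonormal_frame g es by (rule frame)
  have "(\<Sum>i<m. e (es ! i) * g (br E x) (es ! i)) = e (br E x)"
    using linear_expand_real[OF e_linear, of "br E x"] by (simp add: mult.commute)
  then have "(\<Sum>i<m. e (es ! i) * g (br E x) (es ! i)) = 0"
    by (simp add: e_br)
  then show ?thesis
    unfolding trace_def
    by (subst br_formula[OF E])
      (simp add: linear_diff[OF linear_g(2)] linear_scale[OF linear_g(2)] sum_subtractf sum_distrib_left)
qed

text \<open>For \<open>E\<close> normal to the ideal, \<open>c * e\<close> and
  \<open>c * (e \<circ> J)\<close> are components along \<open>E\<close> and \<open>- J E\<close>.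
  The star d star formula then becomes the pairing of \<open>[E, J E] - tr(ad E) J E\<close> with an
  arbitrary \<open>Y\<close>.\<close>

lemma balanced_normal_vector:
  assumes h: "hermitian_metric J g" and frame: "orthonormal_frame g es"
    and bal: "\<And>Y. hodge_star g es (ce_d br (hodge_star g es (fundamental_form J g))) [Y] = 0"
  obtains E where "e E = 1" "e (J E) = 0"
    "br E (J E) = orthonormal_frame.trace g es (br E) *\<^sub>R J E"
proof -
  interpret orthonormal_frame g es by (rule frame)
  obtain E c where E: "e E = 1" "e (J E) = 0" and c: "c > 0" and gE: "\<And>x. g E x = c * e x"
    using normal_vector[OF h frame] by blast
  have gJ: "g (J x) (J y) = g x y" for x y using h by (simp add: hermitian_metric_def)
  have gJE: "c * e (J x) = - g (J E) x" for x
    using gE[of "J x"] hermitian_anti[OF h, of E x] by simp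
  have 0: "(\<Sum>i<m. g (br (es ! i) (J (es ! i))) Y) + 2 * trace (br (J Y)) = 0" for Y
    using bal[of Y] hodge_star_fundamental_form[OF J_linear JJ gJ br_bilinear br_self, of Y]
    by (simp add: trace_def)
  \<comment> \<open>Both halves of \<open>br_formula\<close> are frame expansions, one of
    \<open>E\<close> and one of \<open>J E\<close>, and each sums to
    \<open>[E, J E]\<close>.\<close>
  have "c *\<^sub>R (\<Sum>i<m. br (es ! i) (J (es ! i))) =
      (\<Sum>i<m. (c * e (es ! i)) *\<^sub>R br E (J (es ! i)) - (c * e (J (es ! i))) *\<^sub>R br E (es ! i))"
    unfolding scaleR_sum_right
    by (intro sum.cong refl) (subst br_formula[OF E(1)], simp add: scaleR_diff_right)
  also have "\<dots> = (\<Sum>i<m. g E (es ! i) *\<^sub>R br E (J (es ! i))) + (\<Sum>i<m. g (J E) (es ! i) *\<^sub>R br E (es ! i))"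
    by (simp add: gE gJE sum.distrib)
  also have "\<dots> = br E (J E) + br E (J E)"
    using linear_expand[OF linear_compose[OF J_linear br_linear(1)]] linear_expand[OF br_linear(1)]
    by (simp add: o_def)
  finally have sum: "c *\<^sub>R (\<Sum>i<m. br (es ! i) (J (es ! i))) = 2 *\<^sub>R br E (J E)"
    by (simp add: scaleR_2)
  have "g (br E (J E) - trace (br E) *\<^sub>R J E) Y = 0" for Y
  proof -
    have "c * (\<Sum>i<m. g (br (es ! i) (J (es ! i))) Y) = g (c *\<^sub>R (\<Sum>i<m. br (es ! i) (J (es ! i)))) Y"
      by (simp add: linear_scale[OF linear_g(2)] linear_sum[OF linear_g(2)])
    also have "\<dots> = 2 * g (br E (J E)) Y"
      unfolding sum by (simp add: linear_scale[OF linear_g(2)])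
    finally have eq: "c * (\<Sum>i<m. g (br (es ! i) (J (es ! i))) Y) = 2 * g (br E (J E)) Y" .
    have "c * ((\<Sum>i<m. g (br (es ! i) (J (es ! i))) Y) + 2 * trace (br (J Y))) = 0"
      by (simp only: 0 mult_zero_right)
    then have "2 * g (br E (J E)) Y + 2 * (c * e (J Y)) * trace (br E) = 0"
      unfolding distrib_left eq trace_ad[OF frame E(1), of "J Y"] by (simp only: mult_ac)
    then show ?thesis
      by (simp add: gJE linear_diff[OF linear_g(2)] linear_scale[OF linear_g(2)] algebra_simps)
  qed
  then have "br E (J E) - trace (br E) *\<^sub>R J E = 0"
    using inner unfolding inner_product_def by (metis less_irrefl)
  then show thesis using that E by simp
qed

section \<open>The torsion form and the twisted SKT equation\<close>

lemma bismut_torsion_3: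
  assumes h: "hermitian_metric J g"
  shows "bismut_torsion br J g [X, Y, Z] =
    g (br (J X) (J Y)) Z + g (br (J Y) (J Z)) X + g (br (J Z) (J X)) Y"
proof -
  \<comment> \<open>This removes the \<open>J\<close> of the fundamental form against the
    \<open>J\<close> on its second argument.\<close>
  have gJ: "g (J x) (J y) = g x y" for x y using h by (simp add: hermitian_metric_def)
  have g_neg: "g (- x) y = - g x y" for x y
    using h bilinear_lneg[of g] by (auto simp: hermitian_metric_def inner_product_def)
  have "{..<3::nat} = {0, 1, 2}" "{..<2::nat} = {0, 1}" "{..<Suc 0} = {0}" by auto
  then show ?thesis
    using br_anti[of "J Z" "J X"]
    by (simp add: bismut_torsion_def ce_d_def fundamental_form_def eval_nat_numeral lessThan_Suc nths_Cons gJ g_neg)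
qed

lemma kaehler_iff:
  "kaehler br J g \<longleftrightarrow> (\<forall>X Y Z. g (J (br X Y)) Z - g (J (br X Z)) Y + g (J (br Y Z)) X = 0)"
proof -
  have "ce_d br (fundamental_form J g) [X, Y, Z] =
      - (g (J (br X Y)) Z - g (J (br X Z)) Y + g (J (br Y Z)) X)" for X Y Z
    by (simp add: ce_d_def fundamental_form_def eval_nat_numeral lessThan_Suc nths_Cons)
  then show ?thesis by (simp only: kaehler_def neg_equal_0_iff_equal)
qed

lemma ce_d_4:
  "ce_d br H [X, Y, Z, W] = - H [br X Y, Z, W] + H [br X Z, Y, W] - H [br Y Z, X, W]
     - H [br X W, Y, Z] + H [br Y W, X, Z] - H [br Z W, X, Y]"
  by (simp add: ce_d_def eval_nat_numeral lessThan_Suc nths_Cons)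

lemma wedge1_4:
  "wedge1 \<alpha> H [X, Y, Z, W] = \<alpha> X * H [Y, Z, W] - \<alpha> Y * H [X, Z, W] + \<alpha> Z * H [X, Y, W] - \<alpha> W * H [X, Y, Z]"
  by (simp add: wedge1_def eval_nat_numeral lessThan_Suc nths_Cons)

text \<open>Two evaluations suffice: on \<open>E, F, x, y\<close> (\<open>eq1\<close>) and on
  \<open>F, x, y, z\<close> (\<open>eq2\<close>), where \<open>F = - J E\<close> and
  \<open>x, y, z\<close> lie in \<nn>_1, the common kernel of \<open>e\<close> and
  \<open>e \<circ> J\<close>. The hypothesis \<open>tr\<close> makes the compression of
  \<open>ad\<close> at \<open>E\<close> to \<nn>_1 trace-free.\<close>

lemma skew_of_twisted_SKT:
  assumes h: "hermitian_metric J g" and frame: "orthonormal_frame g es"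
    and skt: "twisted_SKT br J g"
    and E: "e E = 1" "e (J E) = 0" and gE: "\<And>x. g E x = c * e x"
    and tr: "orthonormal_frame.trace g es (br E) = - e (J (br E (J E)))"
    and xy: "e x = 0" "e (J x) = 0" "e y = 0" "e (J y) = 0"
  shows "g (br E x) y + g x (br E y) = 0"
proof -
  interpret orthonormal_frame g es by (rule frame)
  obtain \<alpha> where \<alpha>: "closed_one_form br \<alpha>"
    and twisted: "\<And>X Y Z W. ce_d br (bismut_torsion br J g) [X, Y, Z, W] =
      wedge1 \<alpha> (bismut_torsion br J g) [X, Y, Z, W]"
    using skt by (auto simp: twisted_SKT_def)
  have \<alpha>_linear: "linear \<alpha>" and \<alpha>_br: "\<alpha> (br X Y) = 0" for X Y
    using \<alpha> by (auto simp: closed_one_form_def ce_d_def one_form_def lessThan_Suc eval_nat_numeral nths_Cons)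
  have gJ: "g (J x) (J y) = g x y" for x y using h by (simp add: hermitian_metric_def)
  note gJ_anti = hermitian_anti[OF h]
  note g_simps = linear_add[OF linear_g(1)] linear_add[OF linear_g(2)]
    linear_scale[OF linear_g(1)] linear_scale[OF linear_g(2)]
    linear_diff[OF linear_g(1)] linear_diff[OF linear_g(2)]
    linear_neg[OF linear_g(1)] linear_neg[OF linear_g(2)]
    linear_0[OF linear_g(1)] linear_0[OF linear_g(2)]
  \<comment> \<open>The sign gives \<open>e (J F) = 1\<close>, so \<open>e \<circ> J\<close> reads
    off the \<open>F\<close>-component; in particular \<open>a\<close> is that of
    \<open>B F\<close>.\<close>
  define F where "F = - J E"
  define B where "B = br E"
  define H where "H X Y Z = g (br (J X) (J Y)) Z + g (br (J Y) (J Z)) X + g (br (J Z) (J X)) Y" for X Y Z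
  define a where "a = e (J (B F))"
  define s where "s x y = g (B x) y + g x (B y)" for x y
  have F: "e F = 0" "e (J F) = 1" "J F = E"
    using E by (simp_all add: F_def e_simps J_simps)
  have tr': "trace B = a"
    using tr by (simp add: a_def B_def F_def e_simps J_simps br_simps)
  have gF: "g F x = c * e (J x)" "g x F = c * e (J x)" "g x E = c * e x" for x
    using gE[of "J x"] gE[of x] gJ_anti[of E x] g_sym[of x] by (simp_all add: F_def g_simps)
  have eB: "e (B x) = 0" for x by (simp add: B_def e_br)
  have BJ: "B (J x) = J (B x)" "e (J (B x)) = 0" if "e x = 0" "e (J x) = 0" for x
    using br_J_commute[OF E that] e_J_br[OF E that] by (simp_all add: B_def)
  have s_sym: "s x y = s y x" for x y
    by (simp add: s_def g_sym[of _ "B _"])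
  have s_J: "s (J x) (J y) = s x y" if "e x = 0" "e (J x) = 0" "e y = 0" "e (J y) = 0" for x y
    using that by (simp add: s_def BJ gJ)
  have H: "H X Y Z = bismut_torsion br J g [X, Y, Z]" for X Y Z
    by (simp add: H_def bismut_torsion_3[OF h])
  have H_swap: "H Y X Z = - H X Y Z" for X Y Z
    unfolding H_def using br_anti[of "J Y" "J X"] br_anti[of "J X" "J Z"] br_anti[of "J Z" "J Y"]
    by (simp add: g_simps)
  have H_zero: "H 0 Y Z = 0" for Y Z
    by (simp add: H_def br_simps J_simps g_simps)
  \<comment> \<open>With two arguments in \<nn>_1 the torsion sees only the
    \<open>F\<close>-component of the third: it vanishes for \<open>E\<close> and equals
    \<open>s (J x) y\<close> for \<open>F\<close>.\<close>
  have H_eq: "H X x y = e (J X) * s (J x) y" if "e x = 0" "e (J x) = 0" "e y = 0" "e (J y) = 0" for X x y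
  proof -
    have "br (J X) (J x) = e (J X) *\<^sub>R B (J x)" "br (J y) (J X) = - (e (J X) *\<^sub>R B (J y))"
      "br (J x) (J y) = 0"
      using that br_formula[OF E(1), of "J X" "J x"] br_formula[OF E(1), of "J y" "J X"]
      by (simp_all add: B_def br_kernel)
    then have "H X x y = e (J X) * (g (B (J x)) y - g (B (J y)) x)"
      by (simp add: H_def g_simps algebra_simps)
    also have "g (B (J y)) x = - g (J x) (B y)"
      using that by (simp add: BJ gJ_anti[of "B y" x] g_sym[of "B y"])
    finally show ?thesis by (simp add: s_def algebra_simps)
  qed
  have s_J_anti: "s (J x) y = - s x (J y)" if "e x = 0" "e (J x) = 0" "e y = 0" "e (J y) = 0" for x y
    using that s_J[of x "J y"] by (simp add: J_simps e_simps s_def g_simps br_simps B_def)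
  have H_EF: "H E F y = g (B F) y" if "e y = 0" "e (J y) = 0" for y
  proof -
    have "br (J E) E = B F"
      using br_anti[of "J E" E] by (simp add: B_def F_def br_simps)
    moreover have "br (J y) (J E) = 0"
      using that E by (simp add: br_kernel)
    ultimately show ?thesis
      using that by (simp add: H_def F gE g_simps e_br gF(3))
  qed
  have eq1: "s (J (B x)) y + s (J x) (B y) + (a + \<alpha> E) * s (J x) y
      + \<alpha> x * g (B F) y - \<alpha> y * g (B F) x = 0"
    if xy: "e x = 0" "e (J x) = 0" "e y = 0" "e (J y) = 0" for x y
  proof -
    have br0: "br F x = 0" "br F y = 0" "br x y = 0"
      using xy F by (simp_all add: br_kernel)
    have "- H (B F) x y + H (B x) F y - H (B y) F x =
        \<alpha> E * H F x y - \<alpha> F * H E x y + \<alpha> x * H E F y - \<alpha> y * H E F x"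
      using twisted[of E F x y]
      by (simp add: ce_d_4 wedge1_4 H[symmetric] br0 H_zero B_def[symmetric])
    moreover have "H (B x) F y = - H F (B x) y" "H (B y) F x = - H F (B y) x"
      by (rule H_swap)+
    moreover have "s (J (B y)) x = - s (J x) (B y)"
      using s_J_anti[of x "B y"] s_sym[of x] xy by (simp add: eB BJ)
    ultimately show ?thesis
      using xy E F by (simp add: H_eq H_EF eB BJ a_def algebra_simps)
  qed
  \<comment> \<open>All four vectors lie in the abelian ideal, so dH vanishes there and only
    \<alpha> \<and> H remains.\<close>
  have eq2: "\<alpha> x * s (J y) z - \<alpha> y * s (J x) z + \<alpha> z * s (J x) y = 0"
    if "e x = 0" "e (J x) = 0" "e y = 0" "e (J y) = 0" "e z = 0" "e (J z) = 0" for x y z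
  proof -
    have "br F x = 0" "br F y = 0" "br F z = 0" "br x y = 0" "br x z = 0" "br y z = 0"
      using that F by (simp_all add: br_kernel)
    then have "\<alpha> F * H x y z - \<alpha> x * H F y z + \<alpha> y * H F x z - \<alpha> z * H F x y = 0"
      using twisted[of F x y z] by (simp add: ce_d_4 wedge1_4 H[symmetric] H_zero)
    then show ?thesis
      using that F by (simp add: H_eq algebra_simps)
  qed
  \<comment> \<open>The projection onto \<nn>_1 along \<open>E\<close> and \<open>F\<close>; it is
    orthogonal because \<open>E\<close> is normal to the ideal and \<open>F = - J E\<close>.\<close>
  define P where "P x = x - e x *\<^sub>R E - e (J x) *\<^sub>R F" for x
  have eP: "e (P x) = 0" "e (J (P x)) = 0" for x
    using E F by (simp_all add: P_def e_simps J_simps)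
  have P_id: "P x = x" if "e x = 0" "e (J x) = 0" for x
    using that by (simp add: P_def)
  have P_sym: "g (P x) y = g x (P y)" for x y
    by (simp add: P_def g_simps gE gF algebra_simps)
  have J_ker: "e (J (J x)) = 0" if "e x = 0" for x
    using that by (simp add: J_simps e_simps)
  show ?thesis
  proof (cases "\<exists>z. e z = 0 \<and> e (J z) = 0 \<and> \<alpha> z \<noteq> 0")
    case True
    then obtain z where z: "e z = 0" "e (J z) = 0" "\<alpha> z \<noteq> 0" by auto
    \<comment> \<open>\<open>u\<close> is dual to the restriction of \<open>\<alpha>\<close> to
      \<nn>_1.\<close>
    define u where "u = P (\<Sum>i<m. \<alpha> (es ! i) *\<^sub>R es ! i)"
    have u: "e u = 0" "e (J u) = 0" by (simp_all add: u_def eP)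
    have gu: "g u y = \<alpha> y" if "e y = 0" "e (J y) = 0" for y
      using that by (simp add: u_def P_sym P_id dual_vector[OF \<alpha>_linear])
    have "u \<noteq> 0"
      using gu[of z] z by (auto simp: g_simps)
    then have "g u u > 0" using inner by (simp add: inner_product_def)
    then have \<alpha>u: "\<alpha> u \<noteq> 0" using gu[OF u] by simp
    have \<alpha>Ju: "\<alpha> (J u) = 0"
      using gu[of "J u"] u hermitian_J_self[OF h, of u] by (simp add: J_ker)
    \<comment> \<open>Closedness makes \<open>\<alpha>\<close> vanish on brackets.\<close>
    have "g u (B u) = 0"
      using gu[OF eB BJ(2)[OF u]] by (simp add: B_def \<alpha>_br)
    then have suu: "s u u = 0" by (simp add: s_def g_sym[of "B u"])
    \<comment> \<open>In \<open>eq2\<close> at \<open>u, J u, w\<close> only the terms with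
      \<open>s u w\<close> and \<open>s u u\<close> are left.\<close>
    have su: "s u w = 0" if w: "e w = 0" "e (J w) = 0" for w
      using eq2[of u "J u" w] u w \<alpha>u suu s_J[OF u u]
      by (simp add: J_ker \<alpha>Ju) (simp add: J_simps s_def B_def br_simps g_simps)
    \<comment> \<open>In \<open>eq2\<close> at \<open>u, v, w\<close> the terms containing
      \<open>u\<close> inside \<open>s\<close> vanish by \<open>su\<close>.\<close>
    have sJ0: "s (J v) w = 0" if v: "e v = 0" "e (J v) = 0" and w: "e w = 0" "e (J w) = 0" for v w
      using eq2[of u v w] u v w \<alpha>u su[of "J v"] su[of "J w"] s_J_anti[OF u v] s_J_anti[OF u w]
      by (simp add: J_ker)
    have "s (J (J x)) y = 0"
      using xy by (intro sJ0) (simp_all add: J_ker)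
    then show ?thesis
      by (simp add: J_simps s_def B_def br_simps g_simps)
  next
    case False
    then have \<alpha>0: "\<alpha> z = 0" if "e z = 0" "e (J z) = 0" for z using that by auto
    \<comment> \<open>Putting \<open>J x\<close> for \<open>x\<close> in \<open>eq1\<close> removes
      \<open>J\<close>; the \<open>\<alpha>\<close>-terms on \<nn>_1 are zero in this case.\<close>
    have eq: "s (B x) y + s x (B y) + (a + \<alpha> E) * s x y = 0"
      if "e x = 0" "e (J x) = 0" "e y = 0" "e (J y) = 0" for x y
    proof -
      have "s (J (B (J x))) y + s (J (J x)) (B y) + (a + \<alpha> E) * s (J (J x)) y = 0"
        using eq1[of "J x" y] that by (simp add: J_ker \<alpha>0)
      moreover have "J (B (J x)) = - B x" "J (J x) = - x"
        using that by (simp_all add: BJ J_simps)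
      moreover have "s (- v) w = - s v w" for v w
        by (simp add: s_def B_def br_simps g_simps)
      ultimately show ?thesis by simp
    qed
    \<comment> \<open>Extension by zero of the restriction of \<open>B\<close> to \<nn>_1, so that
      traces can be taken over the full frame.\<close>
    define A where "A x = B (P x)" for x
    have A_linear: "linear A"
      unfolding A_def P_def B_def
      by (rule linearI) (simp_all add: e_simps J_simps br_simps algebra_simps)
    have PA: "P (A x) = A x" for x
      by (simp add: A_def P_id eB BJ eP)
    have gA: "g (A x) (P y) = g (A x) y" for x y
      using P_sym[of "A x" y] by (simp add: PA)
    have sP: "s (P x) (P y) = g (A x) y + g x (A y)" for x y
      using gA[of x y] gA[of y x] by (simp add: s_def g_sym[of _ "B _"] g_sym[of _ "A _"] flip: A_def)
    have "trace A = 0"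
    proof -
      \<comment> \<open>\<open>B E = 0\<close>, so projecting removes from the trace just the
        \<open>F\<close>-component \<open>a\<close> of \<open>B F\<close>.\<close>
      have "trace A = trace B - (\<Sum>i<m. e (J (es ! i)) * g (B F) (es ! i))"
        unfolding trace_def sum_subtractf[symmetric]
        by (intro sum.cong refl) (simp add: A_def P_def B_def br_simps br_self g_simps)
      also have "(\<Sum>i<m. e (J (es ! i)) * g (B F) (es ! i)) = a"
        using linear_expand_real[OF linear_compose[OF J_linear e_linear], of "B F"]
        by (simp add: a_def o_def mult.commute)
      finally show ?thesis using tr' by simp
    qed
    moreover have "2 * (g (A (A x)) x + g (A x) (A x)) + (a + \<alpha> E) * (2 * g (A x) x) = 0" for x
    proof -
      have "s (A x) (P x) + s (P x) (A x) + (a + \<alpha> E) * s (P x) (P x) = 0"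
        using eq[of "P x" "P x"] by (simp add: eP A_def)
      moreover have "s (A x) (P x) = g (A (A x)) x + g (A x) (A x)"
        using sP[of "A x" x] by (simp add: PA)
      ultimately show ?thesis
        using s_sym[of "P x" "A x"] g_sym[of x "A x"] by (simp add: sP)
    qed
    ultimately have "g (A x) y + g x (A y) = 0"
      by (rule skew_if_trace_zero[OF A_linear])
    then show ?thesis using xy by (simp add: A_def P_id B_def)
  qed
qed

section \<open>Construction of the Kaehler metric\<close>

lemma exists_kaehler:
  assumes h: "hermitian_metric J g" and E: "e E = 1" "e (J E) = 0"
    and eigen: "br E (J E) = \<tau> *\<^sub>R J E"
    and skew: "\<And>x y. \<lbrakk>e x = 0; e (J x) = 0; e y = 0; e (J y) = 0\<rbrakk> \<Longrightarrow> g (br E x) y + g x (br E y) = 0"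
  shows "\<exists>g. hermitian_metric J g \<and> kaehler br J g"
proof -
  have g: "inner_product g" and gJ: "\<And>x y. g (J x) (J y) = g x y"
    using h by (auto simp: hermitian_metric_def)
  have linear_g: "linear (g z)" "linear (\<lambda>x. g x z)" for z
    using g by (simp_all add: inner_product_def bilinear_def)
  have g_sym: "g x y = g y x" for x y using g by (simp add: inner_product_def)
  have g_pos: "x \<noteq> 0 \<Longrightarrow> g x x > 0" for x using g by (simp add: inner_product_def)
  \<comment> \<open>The plus sign reflects \<open>e (J (J E)) = - 1\<close>.\<close>
  define P where "P x = x - e x *\<^sub>R E + e (J x) *\<^sub>R J E" for x
  define G where "G x y = e x * e y + e (J x) * e (J y) + g (P x) (P y)" for x y
  have P_linear: "linear P"
    unfolding P_def by (rule linearI) (simp_all add: e_simps J_simps algebra_simps)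
  have eP: "e (P x) = 0" "e (J (P x)) = 0" for x
    using E by (simp_all add: P_def e_simps J_simps)
  have PJ: "P (J x) = J (P x)" for x
    by (simp add: P_def J_simps e_simps algebra_simps)
  have bil: "bilinear G"
    unfolding bilinear_def G_def
    by (intro conjI allI linearI)
      (simp_all add: e_simps J_simps linear_add[OF P_linear] linear_scale[OF P_linear]
        linear_add[OF linear_g(1)] linear_add[OF linear_g(2)]
        linear_scale[OF linear_g(1)] linear_scale[OF linear_g(2)] algebra_simps)
  have pos: "G x x > 0" if "x \<noteq> 0" for x
  proof (cases "e x = 0 \<and> e (J x) = 0")
    case True
    then show ?thesis using g_pos[OF that] by (simp add: G_def P_def)
  next
    case False
    have "g y y \<ge> 0" for y
      using g_pos[of y] linear_0[OF linear_g(1), of 0] by (cases "y = 0") auto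
    moreover have "e x * e x + e (J x) * e (J x) > 0"
      using False by (simp add: sum_squares_gt_zero_iff)
    ultimately show ?thesis unfolding G_def by (metis add_pos_nonneg)
  qed
  have "hermitian_metric J G"
    unfolding hermitian_metric_def inner_product_def
    using bil pos by (auto simp: G_def PJ gJ J_simps e_simps g_sym mult.commute)
  moreover have "kaehler br J G"
    unfolding kaehler_iff
  proof (intro allI)
    fix X Y Z
    \<comment> \<open>The form of JA on \<nn>_1, A being \<open>ad\<close> at \<open>E\<close>; it
      is symmetric since A is skew and commutes with J.\<close>
    define k where "k y z = g (J (br E (P y))) (P z)" for y z
    have k_sym: "k y z = k z y" for y z
    proof -
      have "g (br E (J (P y))) (P z) + g (J (P y)) (br E (P z)) = 0"
        using skew[of "J (P y)" "P z"] by (simp add: eP JJ e_simps)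
      moreover have "g (J (P y)) (br E (P z)) = - g (P y) (J (br E (P z)))"
        by (rule hermitian_anti[OF h])
      ultimately show ?thesis
        using br_J_commute[OF E eP] by (simp add: k_def g_sym[of "P y"])
    qed
    \<comment> \<open>The eigenvector condition makes \<open>ad\<close> at \<open>E\<close> respect
      the splitting into \<open>E\<close>, \<open>J E\<close> and \<nn>_1.\<close>
    have split: "br E y = br E (P y) - (e (J y) * \<tau>) *\<^sub>R J E" for y
      by (simp add: P_def br_simps br_self eigen)
    have e_J: "e (J (br E y)) = \<tau> * e (J y)" for y
      using E by (subst split) (simp add: e_simps J_simps e_J_br[OF E eP])
    have P_br: "P (br E y) = br E (P y)" for y
    proof -
      have "P (br E (P y)) = br E (P y)"
        by (simp add: P_def[of "br E _"] e_br e_J_br[OF E eP])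
      moreover have "P (J E) = 0"
        using E by (simp add: P_def J_simps e_simps)
      ultimately show ?thesis
        by (subst split) (simp add: linear_diff[OF P_linear] linear_scale[OF P_linear])
    qed
    \<comment> \<open>In the cyclic sum every \<open>\<tau>\<close>-product occurs twice with
      opposite signs, and the \<open>k\<close>-terms cancel by symmetry.\<close>
    have omega: "G (J (br X Y)) Z =
        e X * (\<tau> * e (J Y) * e Z + k Y Z) - e Y * (\<tau> * e (J X) * e Z + k X Z)" for X Y Z
      by (simp add: G_def br_formula[OF E(1), of X Y] e_simps J_simps e_J PJ
          linear_diff[OF P_linear] linear_scale[OF P_linear] P_br k_def
          linear_diff[OF linear_g(2)] linear_scale[OF linear_g(2)] algebra_simps)
    show "G (J (br X Y)) Z - G (J (br X Z)) Y + G (J (br Y Z)) X = 0"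
      unfolding omega using k_sym[of X Y] k_sym[of X Z] k_sym[of Y Z]
      by (simp add: algebra_simps)
  qed
  ultimately show ?thesis by auto
qed

end

section \<open>From the codimension-one ideal to its defining functional\<close>

lemma codim1_functional:
  assumes fin: "\<exists>B::'a::real_vector set. finite B \<and> span B = UNIV"
    and N: "subspace (N :: 'a::real_vector set)" "dim N + 1 = dim (UNIV :: 'a::real_vector set)"
  obtains e :: "'a::real_vector \<Rightarrow> real" and E where "linear e" "e E = 1" "\<And>x. e x = 0 \<longleftrightarrow> x \<in> N"
proof -
  obtain B where B: "B \<subseteq> N" "independent B" "N \<subseteq> span B" "card B = dim N"
    using real_vector.basis_exists[of N] by metis
  have span_B: "span B = N"
    using B N(1) by (simp add: real_vector.span_subspace)
  have "N \<noteq> UNIV" using N(2) by auto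
  then obtain E where E: "E \<notin> N" by auto
  have "E \<notin> B" using E B(1) by auto
  have ind: "independent (insert E B)"
    using E B(2) by (intro real_vector.independent_insertI) (simp_all add: span_B)
  have "card (insert E B) = dim (UNIV :: 'a set)"
    using independent_card_le_dim[OF fin B(2)] \<open>E \<notin> B\<close> B(4) N(2) by simp
  then have UNIV: "span (insert E B) = UNIV"
    by (rule span_eq_UNIV_if_card[OF fin ind])
  \<comment> \<open>Dual to \<open>E\<close> in a basis of \<open>N\<close> completed by
    \<open>E\<close>.\<close>
  obtain e :: "'a \<Rightarrow> real" where e: "linear e" "\<forall>x\<in>insert E B. e x = (if x = E then 1 else 0)"
    using linear_independent_extend[OF ind, of "\<lambda>x. if x = E then 1 else 0"] by blast
  have zero: "e x = 0" if "x \<in> N" for x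
    using that unfolding span_B[symmetric]
    by (rule linear_eq_0_on_span[OF e(1), rotated]) (use e(2) \<open>E \<notin> B\<close> in auto)
  have "x \<in> N" if "e x = 0" for x
  proof -
    obtain k where k: "x - k *\<^sub>R E \<in> N"
      using UNIV real_vector.span_insert[of E B] span_B by auto
    have "e (x - k *\<^sub>R E) = - k"
      using e that by (simp add: linear_diff[OF e(1)] linear_scale[OF e(1)])
    then show ?thesis using k zero[OF k] by simp
  qed
  then have "e x = 0 \<longleftrightarrow> x \<in> N" for x
    using zero by blast
  moreover have "e E = 1" using e(2) by simp
  ultimately show thesis using that e(1) by blast
qed

lemma almost_abelian_complex_exists:
  assumes "almost_abelian (br :: 'a::real_vector \<Rightarrow> 'a \<Rightarrow> 'a)" and J: "complex_structure br J"
  obtains e where "almost_abelian_complex br J e"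
proof -
  obtain N where fin: "\<exists>B::'a set. finite B \<and> span B = UNIV"
    and lie: "lie_algebra br" and N: "abelian_ideal br N" "dim N + 1 = dim (UNIV :: 'a set)"
    using assms(1) unfolding almost_abelian_def by blast
  have ideal: "subspace N" "\<And>x y. y \<in> N \<Longrightarrow> br x y \<in> N" "\<And>x y. x \<in> N \<Longrightarrow> y \<in> N \<Longrightarrow> br x y = 0"
    using N(1) by (auto simp: abelian_ideal_def)
  obtain e :: "'a \<Rightarrow> real" and E where e: "linear e" "e E = 1" and ker: "\<And>x. e x = 0 \<longleftrightarrow> x \<in> N"
    using codim1_functional[OF fin ideal(1) N(2)] by blast
  have br: "bilinear br" "br x x = 0" for x using lie by (auto simp: lie_algebra_def)
  have lin: "linear (br x)" "linear (\<lambda>y. br y x)" for x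
    using br by (simp_all add: bilinear_def)
  note e_simps = linear_add[OF e(1)] linear_diff[OF e(1)] linear_scale[OF e(1)]
  note br_simps = linear_diff[OF lin(1)] linear_diff[OF lin(2)] linear_scale[OF lin(1)] linear_scale[OF lin(2)]
  have proj: "e (x - e x *\<^sub>R E) = 0" for x
    by (simp add: e_simps e(2))
  have ad: "e (br x y) = 0" if "e y = 0" for x y
    using ideal(2)[of y x] that ker by simp
  have "e (br x y) = 0" for x y
  proof -
    have anti: "br (x - e x *\<^sub>R E) E = - br E (x - e x *\<^sub>R E)"
    proof -
      define z where "z = x - e x *\<^sub>R E"
      have "br (z + E) (z + E) = br z z + br E E + br z E + br E z"
        by (simp add: linear_add[OF lin(1)] linear_add[OF lin(2)])
      then show ?thesis by (fold z_def) (simp add: br eq_neg_iff_add_eq_0)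
    qed
    \<comment> \<open>After splitting off the multiples of \<open>E\<close>, every bracket has an
      entry in the ideal except \<open>br E E\<close>, which is zero.\<close>
    have "e (br x (y - e y *\<^sub>R E)) = 0" "e (br (x - e x *\<^sub>R E) E) = 0"
      using ad[OF proj[of y], of x] ad[OF proj[of x], of E] unfolding anti
      by (simp_all add: linear_neg[OF e(1)])
    then show ?thesis by (simp add: br_simps e_simps br)
  qed
  then have "almost_abelian_complex br J e"
    using br e ideal(3) J by (intro almost_abelian_complex.intro) (auto simp: ker)
  then show thesis by (rule that)
qed

theorem proposition4p1:
  fixes br :: "'a::real_vector \<Rightarrow> 'a \<Rightarrow> 'a" and J :: "'a \<Rightarrow> 'a"
  assumes "almost_abelian br"
    and "complex_structure br J"
    and "\<exists>g. hermitian_metric J g \<and> balanced br J g"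
    and "\<exists>g. hermitian_metric J g \<and> twisted_SKT br J g"
  shows "\<exists>g. hermitian_metric J g \<and> kaehler br J g"
proof -
  obtain g h where g: "hermitian_metric J g" "balanced br J g"
    and h: "hermitian_metric J h" "twisted_SKT br J h"
    using assms(3,4) by auto
  have fin: "\<exists>B::'a set. finite B \<and> span B = UNIV"
    using assms(1) by (simp add: almost_abelian_def)
  obtain e where "almost_abelian_complex br J e"
    using almost_abelian_complex_exists[OF assms(1,2)] by blast
  then interpret almost_abelian_complex br J e .
  have frame: "orthonormal_frame k es" if "hermitian_metric J k" "unitary_basis J k es" for k es
    using that by (intro orthonormal_frame_of_card[OF fin])
      (auto simp: hermitian_metric_def unitary_basis_def orthonormal_list_def)
  \<comment> \<open>The very basis chosen in \<open>lee_form\<close>.\<close>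
  define es where "es = (SOME es. unitary_basis J g es)"
  have "unitary_basis J g es"
    unfolding es_def using exists_unitary_basis[OF fin J_linear JJ g(1)] by (rule someI_ex)
  then have g_frame: "orthonormal_frame g es" by (rule frame[OF g(1)])
  obtain fs where "unitary_basis J h fs"
    using exists_unitary_basis[OF fin J_linear JJ h(1)] by blast
  then have h_frame: "orthonormal_frame h fs" by (rule frame[OF h(1)])
  have "hodge_star g es (ce_d br (hodge_star g es (fundamental_form J g))) [Y] = 0" for Y
  proof -
    \<comment> \<open>The argument \<open>- J Y\<close> undoes the \<open>J\<close> in the Lee
      form.\<close>
    have "lee_form br J g (- J Y) = 0" using g(2) by (simp add: balanced_def)
    then show ?thesis by (simp add: lee_form_def es_def[symmetric] J_simps)
  qed
  then obtain E where E: "e E = 1" "e (J E) = 0"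
    and eigen: "br E (J E) = orthonormal_frame.trace g es (br E) *\<^sub>R J E"
    by (rule balanced_normal_vector[OF g(1) g_frame])
  \<comment> \<open>\<open>E'\<close> is normal for \<open>h\<close>, whereas \<open>E\<close> is
    normal for \<open>g\<close>; their difference lies in \<nn>_1.\<close>
  obtain E' c where E': "e E' = 1" "e (J E') = 0" and hE': "\<And>x. h E' x = c * e x"
    using normal_vector[OF h(1) h_frame] by blast
  have tr: "orthonormal_frame.trace h fs (br E') = orthonormal_frame.trace g es (br E)"
    using trace_ad[OF h_frame E(1), of E'] E'
      orthonormal_frame.trace_basis_independent[OF g_frame h_frame br_linear(1)[of E]] by simp
  have "br E' (J E') = br E (J E')"
    using br_formula[OF E(1), of E' "J E'"] E' by simp
  also have "\<dots> = br E (J E) + br E (J (E' - E))"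
    by (simp add: br_simps J_simps)
  \<comment> \<open>\<open>ad\<close> at \<open>E\<close> maps \<open>J (E' - E)\<close> into
    \<nn>_1, where \<open>e \<circ> J\<close> vanishes, so only the eigenvector \<open>J E\<close>
    contributes.\<close>
  finally have "e (J (br E' (J E'))) = - orthonormal_frame.trace g es (br E)"
    using E E' e_J_br[OF E, of "J (E' - E)"] by (simp add: e_simps J_simps eigen)
  then have "h (br E' x) y + h x (br E' y) = 0"
    if "e x = 0" "e (J x) = 0" "e y = 0" "e (J y) = 0" for x y
    using that tr by (intro skew_of_twisted_SKT[OF h(1) h_frame h(2) E' hE']) simp_all
  \<comment> \<open>On the ideal \<open>ad\<close> at \<open>E'\<close> and at \<open>E\<close>
    agree, so skewness for \<open>h\<close> passes to the balanced \<open>E\<close>.\<close>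
  then show ?thesis
    using E'(1) by (intro exists_kaehler[OF h(1) E eigen]) (simp add: br_formula[OF E(1), of E'])
qed

end
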